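(* Let $g_1,\dots,g_m\in\mathbb{R}[x]=\mathbb{R}[x_1,\dots,x_n]$ and suppose $S=\{x\in\mathbb{R}^n:\ g_1(x)\ge 0,\dots,g_m(x)\ge 0\}$ is compact, convex and has nonempty interior. Let $S_i=\{x\in\mathbb{R}^n:\ g_i(x)\ge0\}$. If each $S_i$ is either sos-convex or poscurv-convex, then $S$ is SDP representable.
   Context: SDP representable: a set $S\subseteq\mathbb{R}^n$ is SDP representable if there exist an integer $N\ge 0$ and real symmetric matrices $F_0,F_1,\dots,F_n,G_1,\dots,G_N$ of a common size such that $S=\{x\in\mathbb{R}^n:\ \exists\, y\in\mathbb{R}^N,\ F_0+\sum_{i=1}^n x_iF_i+\sum_{j=1}^N y_jG_j\succeq 0\}$, where $\succeq 0$ means positive semidefinite. A symmetric matrix polynomial $P(x)$ of size $r\times r$ is SOS if $P(x)=W(x)^TW(x)$ for some (possibly nonsquare) matrix polynomial $W(x)$ with $r$ columns. The set $S_i$ is sos-convex if $g_i$ is a polynomial such that $-\nabla^2g_i(x)$ is SOS. The set $S_i=\{g_i\ge0\}$ is poscurv-convex if $S_i$ is compact and convex, its boundary $\partial S_i$ equals the zero set $\{x\in\mathbb{R}^n:\ g_i(x)=0\}$, $\nabla g_i(x)\ne0$ for all $x\in\partial S_i$, and $\partial S_i$ has positive curvature: $-v^T\nabla^2g_i(x)v>0$ for all $x\in\partial S_i$ and all $0\ne v\in\mathbb{R}^n$ with $v^T\nabla g_i(x)=0$. *)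

theory Defs
  imports "HOL-Analysis.Analysis"
begin

text \<open>Polynomials in \<open>x\<^sub>1, \<dots>, x\<^sub>n\<close> over the reals are identified with the functions
  on \<open>real ^ 'n\<close> they induce (\<open>real_polynomial_function\<close>), which loses nothing as the
  field is infinite.\<close>

text \<open>Matrices whose size is quantified existentially are functions on index pairs, of which
  only the entries with indices below the size are relevant.\<close>

definition symmetric_upto :: "nat \<Rightarrow> (nat \<Rightarrow> nat \<Rightarrow> real) \<Rightarrow> bool" where
  "symmetric_upto s A \<longleftrightarrow> (\<forall>a<s. \<forall>b<s. A a b = A b a)"

definition psd_upto :: "nat \<Rightarrow> (nat \<Rightarrow> nat \<Rightarrow> real) \<Rightarrow> bool" where
  "psd_upto s A \<longleftrightarrow>
     symmetric_upto s A \<and> (\<forall>v :: nat \<Rightarrow> real. 0 \<le> (\<Sum>a<s. \<Sum>b<s. v a * A a b * v b))"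

definition SDP_representable :: "(real ^ 'n) set \<Rightarrow> bool" where
  "SDP_representable S \<longleftrightarrow>
     (\<exists>(N :: nat) (s :: nat) (F0 :: nat \<Rightarrow> nat \<Rightarrow> real) (F :: 'n \<Rightarrow> nat \<Rightarrow> nat \<Rightarrow> real)
        (G :: nat \<Rightarrow> nat \<Rightarrow> nat \<Rightarrow> real).
        symmetric_upto s F0 \<and> (\<forall>i. symmetric_upto s (F i)) \<and>
        (\<forall>j\<in>{1..N}. symmetric_upto s (G j)) \<and>
        S = {x. \<exists>y :: nat \<Rightarrow> real.
               psd_upto s (\<lambda>a b. F0 a b + (\<Sum>i\<in>UNIV. x $ i * F i a b) + (\<Sum>j=1..N. y j * G j a b))})"

text \<open>\<open>P = W\<^sup>T W\<close>, written entrywise, for a \<open>k \<times> r\<close> matrix polynomial \<open>W\<close> with arbitrary \<open>k\<close>.\<close>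

definition SOS_matrix :: "(real ^ 'n \<Rightarrow> real ^ 'r ^ 'r) \<Rightarrow> bool" where
  "SOS_matrix P \<longleftrightarrow>
     (\<exists>(k :: nat) (W :: nat \<Rightarrow> 'r \<Rightarrow> real ^ 'n \<Rightarrow> real).
        (\<forall>l<k. \<forall>i. real_polynomial_function (W l i)) \<and>
        (\<forall>x i j. P x $ i $ j = (\<Sum>l<k. W l i x * W l j x)))"

definition gradient :: "(real ^ 'n \<Rightarrow> real) \<Rightarrow> real ^ 'n \<Rightarrow> real ^ 'n" where
  "gradient g x = (\<chi> i. frechet_derivative g (at x) (axis i 1))"

definition hessian :: "(real ^ 'n \<Rightarrow> real) \<Rightarrow> real ^ 'n \<Rightarrow> real ^ 'n ^ 'n" where
  "hessian g x = jacobian (gradient g) (at x)"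

definition superlevel :: "(real ^ 'n \<Rightarrow> real) \<Rightarrow> (real ^ 'n) set" where
  "superlevel g = {x. g x \<ge> 0}"

text \<open>Both convexity notions belong to the description of the set \<open>superlevel g\<close> by \<open>g\<close>,
  hence are predicates on \<open>g\<close>.\<close>

definition sos_convex :: "(real ^ 'n \<Rightarrow> real) \<Rightarrow> bool" where
  "sos_convex g \<longleftrightarrow> real_polynomial_function g \<and> SOS_matrix (\<lambda>x. - hessian g x)"

definition poscurv_convex :: "(real ^ 'n \<Rightarrow> real) \<Rightarrow> bool" where
  "poscurv_convex g \<longleftrightarrow>
     compact (superlevel g) \<and> convex (superlevel g) \<and>
     frontier (superlevel g) = {x. g x = 0} \<and>
     (\<forall>x\<in>frontier (superlevel g). gradient g x \<noteq> 0) \<and>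
     (\<forall>x\<in>frontier (superlevel g). \<forall>v. v \<noteq> 0 \<longrightarrow> v \<bullet> gradient g x = 0 \<longrightarrow>
        - (v \<bullet> (hessian g x *v v)) > 0)"

end

theory Submission
  imports Defs
begin

text \<open>SDP representability is preserved by intersections, so each \<open>superlevel (g i)\<close> can be
  treated alone. In the moment relaxation, a point \<open>x\<close> is replaced by a functional \<open>L\<close> on
  polynomials with \<open>L 1 = 1\<close> and \<open>L x\<^sub>i = x\<^sub>i\<close>, nonnegative on squares of bounded degree. If
  \<open>- \<nabla>\<^sup>2g\<close> is SOS, then \<open>s \<mapsto> L (z \<mapsto> g (x + s (z - x)))\<close> is concave, whence Jensen's inequality
  \<open>L g \<le> g x\<close>, and the relaxation is exact; compactness plays no role.

  If the boundary is positively curved, the compact convex set is the hull of finitely many pieces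
  cut out by small balls around boundary points, and SDP representability of bounded sets passes to
  the hull of a union. Near a boundary point, \<open>g\<close> can be replaced by \<open>p = g - k/2 g\<^sup>2\<close>, whose Hessian
  is negative definite there. Adding the constraint \<open>L ((\<delta>\<^sup>2 - |z - a|\<^sup>2) f\<^sup>2) \<ge> 0\<close> makes
  multiplication by the oscillation of \<open>\<nabla>\<^sup>2p\<close> an operator of norm \<open>O(\<delta>)\<close> for \<open>sqrt (L (f\<^sup>2))\<close>. So for
  small \<open>\<delta>\<close> the same concavity argument applies with an explicit degree bound, and no
  Positivstellensatz is needed.

  Functionals are represented as signed combinations of evaluations at finitely many fixed nodes;
  this makes them functionals on all functions, so that polynomial identities need not be translated
  into identities of coefficients.\<close>

subsection \<open>Linear matrix inequalities\<close>

text \<open>The lifting variables \<open>y\<close> carry indices from a set of arbitrary type: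
  moment relaxations index them by nodes in space, intersections and hulls by disjoint sums.\<close>

definition affine_expr :: "'j set \<Rightarrow> (real ^ 'n \<Rightarrow> ('j \<Rightarrow> real) \<Rightarrow> real) \<Rightarrow> bool" where
  "affine_expr J \<phi> \<longleftrightarrow>
     (\<exists>c0 cf cg. \<forall>x y. \<phi> x y = c0 + (\<Sum>i\<in>UNIV. x $ i * cf i) + (\<Sum>j\<in>J. y j * cg j))"

lemma affine_expr_const: "affine_expr J (\<lambda>x y. c)"
  unfolding affine_expr_def
  by (rule exI[of _ c], rule exI[of _ "\<lambda>_. 0"], rule exI[of _ "\<lambda>_. 0"]) simp

lemma affine_expr_coord: "affine_expr J (\<lambda>x y. x $ i)"
  unfolding affine_expr_def
  by (rule exI[of _ 0], rule exI[of _ "\<lambda>k. if k = i then 1 else 0"], rule exI[of _ "\<lambda>_. 0"])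
    (simp add: if_distrib cong: if_cong)

lemma affine_expr_var:
  assumes "finite J" "j \<in> J"
  shows "affine_expr J (\<lambda>x y. y j)"
  unfolding affine_expr_def using assms
  by (intro exI[of _ 0] exI[of _ "\<lambda>_. 0"] exI[of _ "\<lambda>k. if k = j then 1 else 0"])
    (simp add: if_distrib cong: if_cong)

lemma affine_expr_add:
  assumes "affine_expr J \<phi>" "affine_expr J \<psi>"
  shows "affine_expr J (\<lambda>x y. \<phi> x y + \<psi> x y)"
proof -
  obtain a f g where 1: "\<And>x y. \<phi> x y = a + (\<Sum>i\<in>UNIV. x $ i * f i) + (\<Sum>j\<in>J. y j * g j)"
    using assms(1) unfolding affine_expr_def by blast
  obtain a' f' g' where 2: "\<And>x y. \<psi> x y = a' + (\<Sum>i\<in>UNIV. x $ i * f' i) + (\<Sum>j\<in>J. y j * g' j)"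
    using assms(2) unfolding affine_expr_def by blast
  show ?thesis unfolding affine_expr_def
    by (rule exI[of _ "a + a'"], rule exI[of _ "\<lambda>i. f i + f' i"], rule exI[of _ "\<lambda>j. g j + g' j"])
      (simp add: 1 2 sum.distrib algebra_simps)
qed

lemma affine_expr_mult:
  assumes "affine_expr J \<phi>"
  shows "affine_expr J (\<lambda>x y. \<phi> x y * c)"
proof -
  obtain a f g where 1: "\<And>x y. \<phi> x y = a + (\<Sum>i\<in>UNIV. x $ i * f i) + (\<Sum>j\<in>J. y j * g j)"
    using assms(1) unfolding affine_expr_def by blast
  show ?thesis unfolding affine_expr_def
    by (rule exI[of _ "a * c"], rule exI[of _ "\<lambda>i. f i * c"], rule exI[of _ "\<lambda>j. g j * c"])
      (simp add: 1 sum_distrib_right algebra_simps sum_distrib_left)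
qed

lemma affine_expr_diff:
  assumes "affine_expr J \<phi>" "affine_expr J \<psi>"
  shows "affine_expr J (\<lambda>x y. \<phi> x y - \<psi> x y)"
  using affine_expr_add[OF assms(1) affine_expr_mult[OF assms(2), of "-1"]] by simp

lemma affine_expr_sum:
  assumes "\<And>k. k \<in> K \<Longrightarrow> affine_expr J (\<phi> k)"
  shows "affine_expr J (\<lambda>x y. \<Sum>k\<in>K. \<phi> k x y)"
  using assms
  by (induction K rule: infinite_finite_induct) (auto intro: affine_expr_const affine_expr_add)

text \<open>The matrix need not be symmetric: only its quadratic form matters, and
  \<open>SDP_representable_LMI\<close> passes to the symmetric part.\<close>

definition LMI :: "'j set \<Rightarrow> (real ^ 'n \<Rightarrow> ('j \<Rightarrow> real) \<Rightarrow> bool) \<Rightarrow> bool" where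
  "LMI J P \<longleftrightarrow> finite J \<and>
     (\<exists>(s::nat) A. (\<forall>a<s. \<forall>b<s. affine_expr J (A a b)) \<and>
        (\<forall>x y. P x y \<longleftrightarrow> (\<forall>v. 0 \<le> (\<Sum>a<s. \<Sum>b<s. v a * A a b x y * v b))))"

text \<open>Moment matrices are indexed by exponents and block matrices by disjoint sums; a
  bijection with an initial segment of the naturals transports test vectors both ways.\<close>

lemma LMI_finite_index:
  fixes A :: "'a \<Rightarrow> 'a \<Rightarrow> real ^ 'n \<Rightarrow> ('j \<Rightarrow> real) \<Rightarrow> real"
  assumes J: "finite J" and I: "finite I"
    and aff: "\<And>a b. a \<in> I \<Longrightarrow> b \<in> I \<Longrightarrow> affine_expr J (A a b)"
    and P: "\<And>x y. P x y \<longleftrightarrow> (\<forall>v. 0 \<le> (\<Sum>a\<in>I. \<Sum>b\<in>I. v a * A a b x y * v b))"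
  shows "LMI J P"
proof -
  obtain h where h: "bij_betw h {..<card I} I"
    using ex_bij_betw_nat_finite[OF I] by (metis atLeast0LessThan)
  define h' where "h' = the_inv_into {..<card I} h"
  have h'h: "h' (h a) = a" if "a < card I" for a
    unfolding h'_def using h that by (simp add: bij_betw_def the_inv_into_f_f)
  have reindex: "(\<Sum>a\<in>I. f a) = (\<Sum>a<card I. f (h a))" for f :: "'a \<Rightarrow> real"
    by (rule sum.reindex_bij_betw[OF h, symmetric])
  have eq: "(\<Sum>a\<in>I. \<Sum>b\<in>I. v a * A a b x y * v b) =
      (\<Sum>a<card I. \<Sum>b<card I. v (h a) * A (h a) (h b) x y * v (h b))" for v x y
    by (simp only: reindex)
  have "P x y \<longleftrightarrow> (\<forall>v. 0 \<le> (\<Sum>a<card I. \<Sum>b<card I. v a * A (h a) (h b) x y * v b))" (is "_ \<longleftrightarrow> ?R")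
    for x y
  proof
    assume p: "P x y"
    show ?R
    proof
      fix v :: "nat \<Rightarrow> real"
      have "0 \<le> (\<Sum>a<card I. \<Sum>b<card I. v (h' (h a)) * A (h a) (h b) x y * v (h' (h b)))"
        using p[unfolded P eq, rule_format, of "\<lambda>a. v (h' a)"] .
      then show "0 \<le> (\<Sum>a<card I. \<Sum>b<card I. v a * A (h a) (h b) x y * v b)"
        by (simp add: h'h)
    qed
  next
    assume R: ?R
    show "P x y" unfolding P eq
    proof
      fix v :: "'a \<Rightarrow> real"
      show "0 \<le> (\<Sum>a<card I. \<Sum>b<card I. v (h a) * A (h a) (h b) x y * v (h b))"
        using R[rule_format, of "\<lambda>a. v (h a)"] .
    qed
  qed
  moreover have "\<forall>a<card I. \<forall>b<card I. affine_expr J (A (h a) (h b))"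
    using aff h by (auto simp: bij_betw_def)
  ultimately show ?thesis
    unfolding LMI_def using J
    by (intro conjI exI[of _ "card I"] exI[of _ "\<lambda>a b. A (h a) (h b)"]) simp_all
qed

lemma LMI_True: "finite J \<Longrightarrow> LMI J (\<lambda>x y. True)"
  by (rule LMI_finite_index[of J "{}::nat set"]) auto

text \<open>Both conditions fit into one block-diagonal matrix. Its form is the sum of two forms in
  independent vectors, and test vectors vanishing on one block recover each condition
  separately.\<close>

lemma LMI_conj:
  assumes "LMI J P" "LMI J Q"
  shows "LMI J (\<lambda>x y. P x y \<and> Q x y)"
proof -
  obtain s :: nat and A where A: "\<And>a b. a < s \<Longrightarrow> b < s \<Longrightarrow> affine_expr J (A a b)"
      "\<And>x y. P x y \<longleftrightarrow> (\<forall>v. 0 \<le> (\<Sum>a<s. \<Sum>b<s. v a * A a b x y * v b))"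
    using assms(1) unfolding LMI_def by blast
  obtain t :: nat and B where B: "\<And>a b. a < t \<Longrightarrow> b < t \<Longrightarrow> affine_expr J (B a b)"
      "\<And>x y. Q x y \<longleftrightarrow> (\<forall>v. 0 \<le> (\<Sum>a<t. \<Sum>b<t. v a * B a b x y * v b))"
    using assms(2) unfolding LMI_def by blast
  define C where "C p q x y =
    (case p of Inl a \<Rightarrow> (case q of Inl b \<Rightarrow> A a b x y | Inr b \<Rightarrow> 0)
      | Inr a \<Rightarrow> (case q of Inl b \<Rightarrow> 0 | Inr b \<Rightarrow> B a b x y))" for p q x y
  have split: "sum f ({..<s} <+> {..<t}) = (\<Sum>a<s. f (Inl a)) + (\<Sum>a<t. f (Inr a))"
    for f :: "nat + nat \<Rightarrow> real"
    by (simp add: sum.Plus)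
  have eq: "(\<Sum>p\<in>{..<s} <+> {..<t}. \<Sum>q\<in>{..<s} <+> {..<t}. v p * C p q x y * v q) =
      (\<Sum>a<s. \<Sum>b<s. v (Inl a) * A a b x y * v (Inl b)) +
      (\<Sum>a<t. \<Sum>b<t. v (Inr a) * B a b x y * v (Inr b))" for v x y
    by (simp only: split) (simp add: C_def)
  show ?thesis
  proof (rule LMI_finite_index[of J "{..<s} <+> {..<t}" C])
    show "finite J" using assms by (simp add: LMI_def)
    show "finite ({..<s} <+> {..<t})" by simp
    show "affine_expr J (C p q)" if "p \<in> {..<s} <+> {..<t}" "q \<in> {..<s} <+> {..<t}" for p q
      using that A(1) B(1) unfolding C_def by (auto simp: affine_expr_const)
    show "P x y \<and> Q x y \<longleftrightarrow>
      (\<forall>v. 0 \<le> (\<Sum>p\<in>{..<s} <+> {..<t}. \<Sum>q\<in>{..<s} <+> {..<t}. v p * C p q x y * v q))" for x y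
    proof
      assume "P x y \<and> Q x y"
      then show "\<forall>v. 0 \<le> (\<Sum>p\<in>{..<s} <+> {..<t}. \<Sum>q\<in>{..<s} <+> {..<t}. v p * C p q x y * v q)"
        unfolding eq A(2) B(2) by (intro allI add_nonneg_nonneg) auto
    next
      assume *: "\<forall>v. 0 \<le> (\<Sum>p\<in>{..<s} <+> {..<t}. \<Sum>q\<in>{..<s} <+> {..<t}. v p * C p q x y * v q)"
      have "0 \<le> (\<Sum>a<s. \<Sum>b<s. v a * A a b x y * v b)" for v
        using *[rule_format, of "case_sum v (\<lambda>_. 0)"] unfolding eq by simp
      moreover have "0 \<le> (\<Sum>a<t. \<Sum>b<t. v a * B a b x y * v b)" for v
        using *[rule_format, of "case_sum (\<lambda>_. 0) v"] unfolding eq by simp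
      ultimately show "P x y \<and> Q x y" unfolding A(2) B(2) by blast
    qed
  qed
qed

lemma LMI_ball:
  assumes "finite J" "finite K" "\<And>k. k \<in> K \<Longrightarrow> LMI J (P k)"
  shows "LMI J (\<lambda>x y. \<forall>k\<in>K. P k x y)"
  using assms(2,3)
proof (induction K rule: finite_induct)
  case empty
  then show ?case using LMI_True[OF assms(1)] by simp
next
  case (insert k K)
  then have "LMI J (\<lambda>x y. P k x y \<and> (\<forall>k\<in>K. P k x y))" by (intro LMI_conj) auto
  then show ?case by simp
qed

lemma LMI_nonneg:
  assumes "finite J" "affine_expr J \<phi>"
  shows "LMI J (\<lambda>x y. 0 \<le> \<phi> x y)"
proof (rule LMI_finite_index[of J "{()}" "\<lambda>_ _. \<phi>"])
  fix x y
  show "0 \<le> \<phi> x y \<longleftrightarrow> (\<forall>v. 0 \<le> (\<Sum>a\<in>{()}. \<Sum>b\<in>{()}. v a * \<phi> x y * v b))"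
  proof
    assume "0 \<le> \<phi> x y"
    then have "0 \<le> t * t * \<phi> x y" for t :: real by simp
    then show "\<forall>v. 0 \<le> (\<Sum>a\<in>{()}. \<Sum>b\<in>{()}. v a * \<phi> x y * v b)" by (simp add: ac_simps)
  next
    assume "\<forall>v. 0 \<le> (\<Sum>a\<in>{()}. \<Sum>b\<in>{()}. v a * \<phi> x y * v b)"
    from this[rule_format, of "\<lambda>_. 1"] show "0 \<le> \<phi> x y" by simp
  qed
qed (use assms in auto)

lemma LMI_eq:
  assumes "finite J" "affine_expr J \<phi>" "affine_expr J \<psi>"
  shows "LMI J (\<lambda>x y. \<phi> x y = \<psi> x y)"
proof -
  have "LMI J (\<lambda>x y. 0 \<le> \<phi> x y - \<psi> x y \<and> 0 \<le> \<psi> x y - \<phi> x y)"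
    by (intro LMI_conj LMI_nonneg affine_expr_diff assms)
  moreover have "(0 \<le> a - b \<and> 0 \<le> b - a) \<longleftrightarrow> a = b" for a b :: real by auto
  ultimately show ?thesis by simp
qed

text \<open>The variables are renumbered from 1, and each matrix is replaced by its symmetric part,
  which has the same quadratic form.\<close>

lemma SDP_representable_LMI:
  fixes P :: "real ^ 'n \<Rightarrow> ('j \<Rightarrow> real) \<Rightarrow> bool"
  assumes "LMI J P"
  shows "SDP_representable {x. \<exists>y. P x y}"
proof -
  obtain s :: nat and A where A: "\<And>a b. a < s \<Longrightarrow> b < s \<Longrightarrow> affine_expr J (A a b)"
      "\<And>x y. P x y \<longleftrightarrow> (\<forall>v. 0 \<le> (\<Sum>a<s. \<Sum>b<s. v a * A a b x y * v b))" and J: "finite J"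
    using assms(1) unfolding LMI_def by blast
  have "\<forall>a b. \<exists>c0 cf cg. a < s \<longrightarrow> b < s \<longrightarrow>
      (\<forall>x y. A a b x y = c0 + (\<Sum>i\<in>UNIV. x $ i * cf i) + (\<Sum>j\<in>J. y j * cg j))"
    using A(1) unfolding affine_expr_def by blast
  then obtain c0 cf cg where c: "\<And>a b x y. a < s \<Longrightarrow> b < s \<Longrightarrow>
      A a b x y = c0 a b + (\<Sum>i\<in>UNIV. x $ i * cf a b i) + (\<Sum>j\<in>J. y j * cg a b j)"
    by metis
  obtain h where h: "bij_betw h {1..card J} J"
    using ex_bij_betw_nat_finite_1[OF J] by blast
  define h' where "h' = the_inv_into {1..card J} h"
  have h'h: "h' (h a) = a" if "a \<in> {1..card J}" for a
    unfolding h'_def using h that by (simp add: bij_betw_def the_inv_into_f_f)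
  define F0 where "F0 a b = (c0 a b + c0 b a) / 2" for a b
  define F where "F i a b = (cf a b i + cf b a i) / 2" for i a b
  define G where "G j a b = (cg a b (h j) + cg b a (h j)) / 2" for j a b
  define B where "B x y a b = F0 a b + (\<Sum>i\<in>UNIV. x $ i * F i a b) + (\<Sum>j=1..card J. y j * G j a b)"
    for x :: "real ^ 'n" and y a b
  have B: "B x (\<lambda>j. y (h j)) a b = (A a b x y + A b a x y) / 2" if "a < s" "b < s" for a b x y
  proof -
    have "(\<Sum>j=1..card J. y (h j) * G j a b) = (\<Sum>j\<in>J. y j * ((cg a b j + cg b a j) / 2))"
      unfolding G_def by (rule sum.reindex_bij_betw[OF h])
    then show ?thesis
      unfolding B_def F0_def F_def using that
      by (simp add: c sum.distrib distrib_left add_divide_distrib flip: sum_divide_distrib)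
  qed
  have form: "(\<Sum>a<s. \<Sum>b<s. v a * B x (\<lambda>j. y (h j)) a b * v b) =
      (\<Sum>a<s. \<Sum>b<s. v a * A a b x y * v b)" for v x y
  proof -
    have "(\<Sum>a<s. \<Sum>b<s. v a * B x (\<lambda>j. y (h j)) a b * v b) =
        (\<Sum>a<s. \<Sum>b<s. (v a * A a b x y * v b) / 2 + (v b * A b a x y * v a) / 2)"
      by (intro sum.cong refl) (simp add: B field_simps)
    also have "\<dots> = (\<Sum>a<s. \<Sum>b<s. v a * A a b x y * v b) / 2 + (\<Sum>a<s. \<Sum>b<s. v b * A b a x y * v a) / 2"
      by (simp add: sum.distrib sum_divide_distrib)
    also have "(\<Sum>a<s. \<Sum>b<s. v b * A b a x y * v a) = (\<Sum>a<s. \<Sum>b<s. v a * A a b x y * v b)"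
      by (rule sum.swap)
    finally show ?thesis by simp
  qed
  have sym: "symmetric_upto s (B x y)" for x y
    unfolding symmetric_upto_def B_def F0_def F_def G_def by (simp add: add.commute)
  \<comment> \<open>Only indices in \<open>{1..card J}\<close> enter the sum, so every
    \<open>y\<close> may be replaced by the pullback of an assignment on \<open>J\<close>. This
    turns a solution of the renumbered problem back into one of \<open>P\<close>.\<close>
  have Bext: "B x y = B x (\<lambda>j. y (h' (h j)))" for x y
    unfolding B_def by (intro ext arg_cong2[where f="(+)"] refl sum.cong) (simp add: h'h)
  have "(\<exists>y. P x y) \<longleftrightarrow> (\<exists>y. psd_upto s (B x y))" for x
  proof
    assume "\<exists>y. P x y"
    then obtain y where "P x y" ..
    then have "psd_upto s (B x (\<lambda>j. y (h j)))"
      unfolding psd_upto_def form using sym A(2) by blast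
    then show "\<exists>y. psd_upto s (B x y)" by blast
  next
    assume "\<exists>y. psd_upto s (B x y)"
    then obtain y where "psd_upto s (B x y)" ..
    then have "psd_upto s (B x (\<lambda>j. y (h' (h j))))" by (subst Bext[symmetric])
    then have "P x (\<lambda>j. y (h' j))"
      unfolding psd_upto_def A(2) using form[of _ x "\<lambda>j. y (h' j)"] by simp
    then show "\<exists>y. P x y" by blast
  qed
  then have "{x. \<exists>y. P x y} = {x. \<exists>y. psd_upto s (B x y)}" by blast
  then have "{x. \<exists>y. P x y} = {x. \<exists>y. psd_upto s (\<lambda>a b. F0 a b +
      (\<Sum>i\<in>UNIV. x $ i * F i a b) + (\<Sum>j=1..card J. y j * G j a b))}"
    unfolding B_def[abs_def] .
  moreover have "symmetric_upto s F0" "\<forall>i. symmetric_upto s (F i)"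
    "\<forall>j\<in>{1..card J}. symmetric_upto s (G j)"
    by (simp_all add: symmetric_upto_def F0_def F_def G_def add.commute)
  ultimately show ?thesis
    unfolding SDP_representable_def by (intro exI conjI)
qed

section \<open>Homogenised pencils, intersections and convex hulls of unions\<close>

text \<open>Weighting the constant term by \<open>t\<close> makes the solutions
  \<open>(t, x, y)\<close> a convex cone, whose slice \<open>t = 1\<close> describes the original
  set.\<close>

definition psd_pencil ::
  "nat \<Rightarrow> nat \<Rightarrow> (nat \<Rightarrow> nat \<Rightarrow> real) \<Rightarrow> ('n::finite \<Rightarrow> nat \<Rightarrow> nat \<Rightarrow> real) \<Rightarrow> (nat \<Rightarrow> nat \<Rightarrow> nat \<Rightarrow> real) \<Rightarrow>
    real \<Rightarrow> ('n \<Rightarrow> real) \<Rightarrow> (nat \<Rightarrow> real) \<Rightarrow> bool" where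
  "psd_pencil N s F0 F G t x y \<longleftrightarrow> (\<forall>v. 0 \<le> (\<Sum>a<s. \<Sum>b<s. v a *
     (t * F0 a b + (\<Sum>i\<in>UNIV. x i * F i a b) + (\<Sum>j=1..N. y j * G j a b)) * v b))"

lemma psd_pencil_add:
  assumes "psd_pencil N s F0 F G t x y" "psd_pencil N s F0 F G t' x' y'"
  shows "psd_pencil N s F0 F G (t + t') (\<lambda>i. x i + x' i) (\<lambda>j. y j + y' j)"
  unfolding psd_pencil_def
proof
  fix v :: "nat \<Rightarrow> real"
  let ?q = "\<lambda>t x y. \<Sum>a<s. \<Sum>b<s. v a *
     (t * F0 a b + (\<Sum>i\<in>UNIV. x i * F i a b) + (\<Sum>j=1..N. y j * G j a b)) * v b"
  have "?q (t + t') (\<lambda>i. x i + x' i) (\<lambda>j. y j + y' j) = ?q t x y + ?q t' x' y'"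
    by (simp add: sum.distrib distrib_right distrib_left)
  then show "0 \<le> ?q (t + t') (\<lambda>i. x i + x' i) (\<lambda>j. y j + y' j)"
    using assms[unfolded psd_pencil_def, THEN spec, of v] by simp
qed

lemma psd_pencil_scale:
  assumes "psd_pencil N s F0 F G t x y" "0 \<le> c"
  shows "psd_pencil N s F0 F G (c * t) (\<lambda>i. c * x i) (\<lambda>j. c * y j)"
  unfolding psd_pencil_def
proof
  fix v :: "nat \<Rightarrow> real"
  let ?q = "\<lambda>t x y. \<Sum>a<s. \<Sum>b<s. v a *
     (t * F0 a b + (\<Sum>i\<in>UNIV. x i * F i a b) + (\<Sum>j=1..N. y j * G j a b)) * v b"
  have "?q (c * t) (\<lambda>i. c * x i) (\<lambda>j. c * y j) = c * ?q t x y"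
    by (simp add: sum_distrib_left distrib_left distrib_right mult_ac)
  then show "0 \<le> ?q (c * t) (\<lambda>i. c * x i) (\<lambda>j. c * y j)"
    using assms(1)[unfolded psd_pencil_def, THEN spec, of v] assms(2) by simp
qed

lemma LMI_psd_pencil:
  assumes "finite J" "affine_expr J \<tau>" "\<And>i. affine_expr J (\<xi> i)"
    "\<And>j. j \<in> {1..N} \<Longrightarrow> affine_expr J (\<upsilon> j)"
  shows "LMI J (\<lambda>x y. psd_pencil N s F0 F G (\<tau> x y) (\<lambda>i. \<xi> i x y) (\<lambda>j. \<upsilon> j x y))"
  unfolding psd_pencil_def
  by (rule LMI_finite_index[of J "{..<s}"
        "\<lambda>a b x y. \<tau> x y * F0 a b + (\<Sum>i\<in>UNIV. \<xi> i x y * F i a b) + (\<Sum>j=1..N. \<upsilon> j x y * G j a b)"])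
     (use assms in \<open>auto intro!: affine_expr_add affine_expr_mult affine_expr_sum\<close>)

lemma SDP_representable_pencil:
  fixes S :: "(real ^ 'n) set"
  assumes "SDP_representable S"
  shows "\<exists>N s F0 F G. \<forall>x. x \<in> S \<longleftrightarrow> (\<exists>y. psd_pencil N s F0 F G 1 (($) x) y)"
proof -
  obtain N s :: nat and F0 and F :: "'n \<Rightarrow> nat \<Rightarrow> nat \<Rightarrow> real" and G where
    sym: "symmetric_upto s F0" "\<forall>i. symmetric_upto s (F i)" "\<forall>j\<in>{1..N}. symmetric_upto s (G j)"
    and S: "S = {x. \<exists>y :: nat \<Rightarrow> real. psd_upto s
        (\<lambda>a b. F0 a b + (\<Sum>i\<in>UNIV. x $ i * F i a b) + (\<Sum>j=1..N. y j * G j a b))}"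
    using assms unfolding SDP_representable_def by blast
  \<comment> \<open>With symmetric coefficient matrices the symmetry clause of
    \<open>psd_upto\<close> holds at every point, so only the quadratic form remains.\<close>
  have "symmetric_upto s (\<lambda>a b. F0 a b + (\<Sum>i\<in>UNIV. x $ i * F i a b) + (\<Sum>j=1..N. y j * G j a b))"
    for x :: "real ^ 'n" and y
    unfolding symmetric_upto_def
  proof (intro allI impI)
    fix a b assume "a < s" "b < s"
    then have 1: "F0 a b = F0 b a" "\<And>i. F i a b = F i b a"
      "\<And>j. j \<in> {1..N} \<Longrightarrow> G j a b = G j b a"
      using sym unfolding symmetric_upto_def by blast+
    have "(\<Sum>j=1..N. y j * G j a b) = (\<Sum>j=1..N. y j * G j b a)"
      by (rule sum.cong) (simp_all only: 1(3))
    then show "F0 a b + (\<Sum>i\<in>UNIV. x $ i * F i a b) + (\<Sum>j=1..N. y j * G j a b) =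
        F0 b a + (\<Sum>i\<in>UNIV. x $ i * F i b a) + (\<Sum>j=1..N. y j * G j b a)"
      by (simp only: 1(1,2))
  qed
  then have "x \<in> S \<longleftrightarrow> (\<exists>y. psd_pencil N s F0 F G 1 (($) x) y)" for x
    unfolding S psd_upto_def psd_pencil_def by simp
  then show ?thesis by blast
qed

lemma SDP_representable_UNIV: "SDP_representable (UNIV :: (real ^ 'n) set)"
  using SDP_representable_LMI[OF LMI_True[of "{}::unit set"]] by simp

lemma SDP_representable_Int:
  fixes S T :: "(real ^ 'n) set"
  assumes "SDP_representable S" "SDP_representable T"
  shows "SDP_representable (S \<inter> T)"
proof -
  obtain N s F0 F G where S: "\<And>x. x \<in> S \<longleftrightarrow> (\<exists>y. psd_pencil N s F0 F G 1 (($) x) y)"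
    using SDP_representable_pencil[OF assms(1)] by blast
  obtain M t E0 E H where T: "\<And>x. x \<in> T \<longleftrightarrow> (\<exists>y. psd_pencil M t E0 E H 1 (($) x) y)"
    using SDP_representable_pencil[OF assms(2)] by blast
  define P where "P x y \<longleftrightarrow> psd_pencil N s F0 F G 1 (\<lambda>i. x $ i) (\<lambda>j. y (Inl j)) \<and>
      psd_pencil M t E0 E H 1 (\<lambda>i. x $ i) (\<lambda>j. y (Inr j))"
    for x :: "real ^ 'n" and y :: "nat + nat \<Rightarrow> real"
  have "LMI ({1..N} <+> {1..M}) P"
    unfolding P_def
    by (intro LMI_conj
        LMI_psd_pencil[where \<tau>="\<lambda>_ _. 1" and \<xi>="\<lambda>i x _. x $ i" and \<upsilon>="\<lambda>j _ y. y (Inl j)"]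
        LMI_psd_pencil[where \<tau>="\<lambda>_ _. 1" and \<xi>="\<lambda>i x _. x $ i" and \<upsilon>="\<lambda>j _ y. y (Inr j)"])
      (auto intro: affine_expr_const affine_expr_coord affine_expr_var)
  then have "SDP_representable {x. \<exists>y. P x y}" by (rule SDP_representable_LMI)
  also have "{x. \<exists>y. P x y} = S \<inter> T"
  proof (intro set_eqI iffI)
    fix x assume "x \<in> {x. \<exists>y. P x y}"
    then show "x \<in> S \<inter> T" unfolding P_def Int_iff S T by blast
  next
    fix x assume "x \<in> S \<inter> T"
    then obtain y z where "psd_pencil N s F0 F G 1 (($) x) y" "psd_pencil M t E0 E H 1 (($) x) z"
      using S T by blast
    then have "P x (case_sum y z)" unfolding P_def by simp
    then show "x \<in> {x. \<exists>y. P x y}" by blast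
  qed
  finally show ?thesis .
qed

lemma SDP_representable_INT:
  assumes "finite I" "\<And>i. i \<in> I \<Longrightarrow> SDP_representable (S i)"
  shows "SDP_representable (\<Inter>i\<in>I. S i)"
  using assms
  by (induction I rule: finite_induct) (auto intro: SDP_representable_UNIV SDP_representable_Int)

text \<open>For \<open>c > 0\<close> this is rescaling. At weight \<open>0\<close> a solution is a
  direction of recession: its nonnegative multiples may be added to any point of \<open>S\<close>,
  so boundedness forces it to vanish.\<close>

lemma psd_pencil_cone_iff:
  fixes S :: "(real ^ 'n) set"
  assumes S: "\<And>x. x \<in> S \<longleftrightarrow> (\<exists>y. psd_pencil N s F0 F G 1 (($) x) y)"
    and bdd: "bounded S" and ne: "S \<noteq> {}" and c: "0 \<le> c"
  shows "(\<exists>y. psd_pencil N s F0 F G c (($) x) y) \<longleftrightarrow> (\<exists>z\<in>S. x = c *\<^sub>R z)"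
proof
  assume "\<exists>y. psd_pencil N s F0 F G c (($) x) y"
  then obtain y where y: "psd_pencil N s F0 F G c (($) x) y" by blast
  show "\<exists>z\<in>S. x = c *\<^sub>R z"
  proof (cases "c = 0")
    case False
    then have "inverse c * c = 1" "0 \<le> inverse c" using c by auto
    then have "psd_pencil N s F0 F G 1 (($) (inverse c *\<^sub>R x)) (\<lambda>j. inverse c * y j)"
      using psd_pencil_scale[OF y, of "inverse c"] by (simp add: vector_scaleR_component[abs_def])
    then have "inverse c *\<^sub>R x \<in> S" using S by blast
    moreover have "x = c *\<^sub>R (inverse c *\<^sub>R x)" using False by simp
    ultimately show ?thesis by blast
  next
    case True
    obtain z w where z: "z \<in> S" and w: "psd_pencil N s F0 F G 1 (($) z) w"
      using ne S by blast
    have ray: "z + t *\<^sub>R x \<in> S" if "0 \<le> t" for t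
    proof -
      have "psd_pencil N s F0 F G 1 (($) (z + t *\<^sub>R x)) (\<lambda>j. w j + t * y j)"
        using psd_pencil_add[OF w psd_pencil_scale[OF y that]] True
        by (simp add: vector_scaleR_component[abs_def] vector_add_component[abs_def])
      then show ?thesis using S by blast
    qed
    obtain B where B: "\<And>p. p \<in> S \<Longrightarrow> norm p \<le> B" using bdd unfolding bounded_iff by blast
    have "x = 0"
    proof (rule ccontr)
      assume "x \<noteq> 0"
      \<comment> \<open>The multiple is long enough that \<open>z + t *\<^sub>R x\<close> would
        violate the norm bound \<open>B\<close>.\<close>
      define t where "t = (B + norm z + 1) / norm x"
      have "0 \<le> B" using B[OF z] norm_ge_zero order_trans by blast
      then have "0 \<le> t" by (simp add: t_def)
      have "B + norm z + 1 = norm (t *\<^sub>R x)"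
        using \<open>0 \<le> B\<close> \<open>x \<noteq> 0\<close> by (simp add: t_def)
      also have "\<dots> \<le> norm (z + t *\<^sub>R x) + norm z"
        using norm_triangle_ineq4[of "z + t *\<^sub>R x" z] by simp
      also have "\<dots> \<le> B + norm z" using B[OF ray[OF \<open>0 \<le> t\<close>]] by simp
      finally show False by simp
    qed
    then show ?thesis using z True by auto
  qed
next
  assume "\<exists>z\<in>S. x = c *\<^sub>R z"
  then obtain z y where "psd_pencil N s F0 F G 1 (($) z) y" "x = c *\<^sub>R z" using S by blast
  then have "psd_pencil N s F0 F G c (($) x) (\<lambda>j. c * y j)"
    using psd_pencil_scale[OF _ c, of N s F0 F G 1 "($) z" y]
    by (simp add: vector_scaleR_component[abs_def])
  then show "\<exists>y. psd_pencil N s F0 F G c (($) x) y" by blast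
qed

text \<open>Homogenise both pencils with weights \<open>t\<close> and \<open>1 - t\<close>; boundedness makes the homogenised
  pencil with weight \<open>0\<close> describe only the origin.\<close>

lemma SDP_representable_convex_hull_Un:
  fixes S T :: "(real ^ 'n) set"
  assumes "SDP_representable S" "bounded S" "convex S" "S \<noteq> {}"
    and "SDP_representable T" "bounded T" "convex T" "T \<noteq> {}"
  shows "SDP_representable (convex hull (S \<union> T))"
proof -
  obtain N s F0 F G where S: "\<And>x. x \<in> S \<longleftrightarrow> (\<exists>y. psd_pencil N s F0 F G 1 (($) x) y)"
    using SDP_representable_pencil[OF assms(1)] by blast
  obtain M r E0 E H where T: "\<And>x. x \<in> T \<longleftrightarrow> (\<exists>y. psd_pencil M r E0 E H 1 (($) x) y)"
    using SDP_representable_pencil[OF assms(5)] by blast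
  \<comment> \<open>A point of the hull is \<open>(1 - t) p + t q\<close>. The lifted vector stores
    \<open>t\<close> at \<open>None\<close>, the coordinates of the whole product \<open>t q\<close>
    at \<open>Some i\<close>, and then the lifting variables of the two pencils; storing the product
    keeps all conditions linear.\<close>
  let ?t = "\<lambda>y :: 'n option + nat + nat \<Rightarrow> real. y (Inl None)"
  let ?z = "\<lambda>(y :: 'n option + nat + nat \<Rightarrow> real) i. y (Inl (Some i))"
  define P where "P x y \<longleftrightarrow> (0 \<le> 1 - ?t y \<and> 0 \<le> ?t y) \<and>
      psd_pencil N s F0 F G (1 - ?t y) (\<lambda>i. x $ i - ?z y i) (\<lambda>j. y (Inr (Inl j))) \<and>
      psd_pencil M r E0 E H (?t y) (?z y) (\<lambda>j. y (Inr (Inr j)))"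
    for x :: "real ^ 'n" and y :: "'n option + nat + nat \<Rightarrow> real"
  define J :: "('n option + nat + nat) set" where "J = UNIV <+> {1..N} <+> {1..M}"
  have "finite J" by (simp add: J_def)
  have "LMI J P"
    unfolding P_def
    by (intro LMI_conj LMI_nonneg
        LMI_psd_pencil[where \<tau>="\<lambda>_ y. 1 - ?t y" and \<xi>="\<lambda>i x y. x $ i - ?z y i"
          and \<upsilon>="\<lambda>j _ y. y (Inr (Inl j))"]
        LMI_psd_pencil[where \<tau>="\<lambda>_ y. ?t y" and \<xi>="\<lambda>i x y. ?z y i"
          and \<upsilon>="\<lambda>j _ y. y (Inr (Inr j))"])
      (auto intro!: \<open>finite J\<close> affine_expr_const affine_expr_coord affine_expr_var affine_expr_diff
        simp: J_def)
  then have "SDP_representable {x. \<exists>y. P x y}" by (rule SDP_representable_LMI)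
  also have "{x. \<exists>y. P x y} = convex hull (S \<union> T)"
    unfolding convex_hull_union_two[OF assms(3,4,7,8)]
  proof (intro set_eqI iffI)
    fix x assume "x \<in> {x. \<exists>y. P x y}"
    then obtain y where P: "P x y" by blast
    define z where "z = (\<chi> i. ?z y i)"
    have eqs: "($) z = ?z y" "($) (x - z) = (\<lambda>i. x $ i - ?z y i)" by (auto simp: z_def)
    have t: "0 \<le> 1 - ?t y" "0 \<le> ?t y" using P by (auto simp: P_def)
    have "\<exists>p\<in>S. x - z = (1 - ?t y) *\<^sub>R p"
      using P unfolding psd_pencil_cone_iff[OF S assms(2,4) t(1), symmetric] P_def eqs by blast
    moreover have "\<exists>q\<in>T. z = ?t y *\<^sub>R q"
      using P unfolding psd_pencil_cone_iff[OF T assms(6,8) t(2), symmetric] P_def eqs by blast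
    ultimately obtain p q where "p \<in> S" "q \<in> T" "x - z = (1 - ?t y) *\<^sub>R p" "z = ?t y *\<^sub>R q"
      by blast
    moreover from this have "x = (1 - ?t y) *\<^sub>R p + ?t y *\<^sub>R q" by (simp add: diff_eq_eq)
    ultimately show "x \<in> {u *\<^sub>R p + v *\<^sub>R q |u v p q. 0 \<le> u \<and> 0 \<le> v \<and> u + v = 1 \<and> p \<in> S \<and> q \<in> T}"
      using t by - (rule CollectI, rule exI[of _ "1 - ?t y"], rule exI[of _ "?t y"],
        rule exI[of _ p], rule exI[of _ q], simp)
  next
    fix x assume "x \<in> {u *\<^sub>R p + v *\<^sub>R q |u v p q. 0 \<le> u \<and> 0 \<le> v \<and> u + v = 1 \<and> p \<in> S \<and> q \<in> T}"
    then obtain v u p q where "x = v *\<^sub>R p + u *\<^sub>R q" "0 \<le> v" "v + u = 1" and u: "0 \<le> u"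
      and pq: "p \<in> S" "q \<in> T" by blast
    moreover from this have "v = 1 - u" by simp
    ultimately have x: "x = (1 - u) *\<^sub>R p + u *\<^sub>R q" and "0 \<le> 1 - u" by auto
    note u = \<open>0 \<le> 1 - u\<close> u
    obtain y where y: "psd_pencil N s F0 F G (1 - u) (($) ((1 - u) *\<^sub>R p)) y"
      using psd_pencil_cone_iff[OF S assms(2,4) u(1)] pq by blast
    obtain w where w: "psd_pencil M r E0 E H u (($) (u *\<^sub>R q)) w"
      using psd_pencil_cone_iff[OF T assms(6,8) u(2)] pq by blast
    have eqs: "(\<lambda>i. x $ i - (u *\<^sub>R q) $ i) = ($) ((1 - u) *\<^sub>R p)" by (auto simp: x)
    have "P x (case_sum (case_option u (($) (u *\<^sub>R q))) (case_sum y w))"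
      unfolding P_def using u y w by (simp only: sum.case option.case eqs)
    then show "x \<in> {x. \<exists>y. P x y}" by blast
  qed
  finally show ?thesis .
qed

lemma SDP_representable_convex_hull_UN:
  fixes S :: "'i \<Rightarrow> (real ^ 'n) set"
  assumes "finite I" "I \<noteq> {}"
    and "\<And>i. i \<in> I \<Longrightarrow> SDP_representable (S i)" "\<And>i. i \<in> I \<Longrightarrow> bounded (S i)"
    and "\<And>i. i \<in> I \<Longrightarrow> convex (S i)" "\<And>i. i \<in> I \<Longrightarrow> S i \<noteq> {}"
  shows "SDP_representable (convex hull (\<Union>i\<in>I. S i))"
  using assms
proof (induction I rule: finite_ne_induct)
  case (singleton i)
  then show ?case by (simp add: hull_same)
next
  case (insert i I)
  have "SDP_representable (convex hull (S i \<union> (convex hull (\<Union>i\<in>I. S i))))"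
    using insert by (intro SDP_representable_convex_hull_Un bounded_convex_hull) auto
  also have "convex hull (S i \<union> (convex hull (\<Union>i\<in>I. S i))) = convex hull (\<Union>i\<in>insert i I. S i)"
    by (simp add: hull_Un_right[symmetric])
  finally show ?case .
qed

subsection \<open>Polynomials of bounded degree\<close>

definition monomial_fun :: "('n::finite \<Rightarrow> nat) \<Rightarrow> real ^ 'n \<Rightarrow> real" where
  "monomial_fun \<alpha> x = (\<Prod>i\<in>UNIV. x $ i ^ \<alpha> i)"

definition exponents :: "nat \<Rightarrow> ('n::finite \<Rightarrow> nat) set" where
  "exponents d = {\<alpha>. (\<Sum>i\<in>UNIV. \<alpha> i) \<le> d}"

definition poly_deg :: "nat \<Rightarrow> (real ^ 'n \<Rightarrow> real) \<Rightarrow> bool" where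
  "poly_deg d f \<longleftrightarrow> (\<exists>c. \<forall>x. f x = (\<Sum>\<alpha>\<in>exponents d. c \<alpha> * monomial_fun \<alpha> x))"

lemma finite_exponents [simp]: "finite (exponents d :: ('n::finite \<Rightarrow> nat) set)"
proof (rule finite_subset)
  show "exponents d \<subseteq> PiE UNIV (\<lambda>_::'n. {..d})"
    unfolding exponents_def PiE_UNIV_domain
    by (auto intro: order_trans[OF member_le_sum[of _ UNIV]])
  show "finite (PiE UNIV (\<lambda>_::'n. {..d}))" by (intro finite_PiE) auto
qed

lemma exponents_mono: "d \<le> e \<Longrightarrow> exponents d \<subseteq> exponents e"
  by (auto simp: exponents_def)

lemma exponents_add: "\<alpha> \<in> exponents d \<Longrightarrow> \<beta> \<in> exponents e \<Longrightarrow> (\<lambda>i. \<alpha> i + \<beta> i) \<in> exponents (d + e)"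
  by (auto simp: exponents_def sum.distrib)

lemma monomial_fun_add: "monomial_fun (\<lambda>i. \<alpha> i + \<beta> i) x = monomial_fun \<alpha> x * monomial_fun \<beta> x"
  by (simp add: monomial_fun_def power_add prod.distrib)

lemma poly_deg_monomial:
  assumes "\<alpha> \<in> exponents d"
  shows "poly_deg d (monomial_fun \<alpha>)"
  unfolding poly_deg_def using assms
  by (intro exI[of _ "\<lambda>\<beta>. if \<beta> = \<alpha> then 1 else 0"]) (simp add: mult_delta_left)

lemma poly_deg_add:
  assumes "poly_deg d f" "poly_deg d g"
  shows "poly_deg d (\<lambda>x. f x + g x)"
proof -
  obtain a b where "\<And>x. f x = (\<Sum>\<alpha>\<in>exponents d. a \<alpha> * monomial_fun \<alpha> x)"
    "\<And>x. g x = (\<Sum>\<alpha>\<in>exponents d. b \<alpha> * monomial_fun \<alpha> x)"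
    using assms unfolding poly_deg_def by blast
  then show ?thesis unfolding poly_deg_def
    by (intro exI[of _ "\<lambda>\<alpha>. a \<alpha> + b \<alpha>"]) (simp add: distrib_right sum.distrib)
qed

lemma poly_deg_cmult:
  assumes "poly_deg d f"
  shows "poly_deg d (\<lambda>x. c * f x)"
proof -
  obtain a where "\<And>x. f x = (\<Sum>\<alpha>\<in>exponents d. a \<alpha> * monomial_fun \<alpha> x)"
    using assms unfolding poly_deg_def by blast
  then show ?thesis unfolding poly_deg_def
    by (intro exI[of _ "\<lambda>\<alpha>. c * a \<alpha>"]) (simp add: sum_distrib_left mult.assoc)
qed

lemma poly_deg_const: "poly_deg d (\<lambda>x. c)"
  using poly_deg_cmult[OF poly_deg_monomial[of "\<lambda>_. 0" d], of c]
  by (simp add: exponents_def monomial_fun_def)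

lemma poly_deg_diff:
  assumes "poly_deg d f" "poly_deg d g"
  shows "poly_deg d (\<lambda>x. f x - g x)"
  using poly_deg_add[OF assms(1) poly_deg_cmult[OF assms(2), of "-1"]] by simp

lemma poly_deg_sum:
  assumes "\<And>k. k \<in> K \<Longrightarrow> poly_deg d (f k)"
  shows "poly_deg d (\<lambda>x. \<Sum>k\<in>K. f k x)"
  using assms
  by (induction K rule: infinite_finite_induct) (auto intro: poly_deg_add poly_deg_const)

lemma poly_deg_mono:
  assumes "poly_deg d f" "d \<le> e"
  shows "poly_deg e f"
proof -
  obtain a where a: "f = (\<lambda>x. \<Sum>\<alpha>\<in>exponents d. a \<alpha> * monomial_fun \<alpha> x)"
    using assms unfolding poly_deg_def by blast
  show ?thesis
    unfolding a using exponents_mono[OF assms(2)]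
    by (intro poly_deg_sum poly_deg_cmult poly_deg_monomial) blast
qed

lemma poly_deg_mult:
  assumes "poly_deg d f" "poly_deg e g"
  shows "poly_deg (d + e) (\<lambda>x. f x * g x)"
proof -
  obtain a b where a: "\<And>x. f x = (\<Sum>\<alpha>\<in>exponents d. a \<alpha> * monomial_fun \<alpha> x)"
    and b: "\<And>x. g x = (\<Sum>\<alpha>\<in>exponents e. b \<alpha> * monomial_fun \<alpha> x)"
    using assms unfolding poly_deg_def by blast
  have "f x * g x = (\<Sum>\<alpha>\<in>exponents d. \<Sum>\<beta>\<in>exponents e.
      (a \<alpha> * b \<beta>) * monomial_fun (\<lambda>i. \<alpha> i + \<beta> i) x)" for x
    by (simp add: a b sum_product monomial_fun_add mult_ac)
  then show ?thesis
    by (simp only:) (intro poly_deg_sum poly_deg_cmult poly_deg_monomial exponents_add)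
qed

lemma poly_deg_coord: "poly_deg 1 (\<lambda>x :: real ^ 'n. x $ i)"
proof -
  have "(\<Prod>k\<in>UNIV. x $ k ^ (if k = i then 1 else 0)) = x $ i" for x :: "real ^ 'n"
    by (simp add: if_distrib[of "\<lambda>m. _ ^ m"] cong: if_cong)
  then have "(\<lambda>x :: real ^ 'n. x $ i) = monomial_fun (\<lambda>k. if k = i then 1 else 0)"
    by (simp add: monomial_fun_def fun_eq_iff)
  moreover have "(\<lambda>k. if k = i then 1 else 0) \<in> exponents 1"
    by (simp add: exponents_def)
  ultimately show ?thesis by (simp only: poly_deg_monomial)
qed

lemma poly_deg_affine_coord: "poly_deg 1 (\<lambda>x. a + s * x $ i)"
  by (intro poly_deg_add poly_deg_const poly_deg_cmult poly_deg_coord)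

lemma poly_deg_power:
  assumes "poly_deg d f"
  shows "poly_deg (m * d) (\<lambda>x. f x ^ m)"
  using poly_deg_mult[OF assms] by (induction m) (auto intro: poly_deg_const)

lemma poly_deg_prod:
  assumes "finite K" "\<And>k. k \<in> K \<Longrightarrow> poly_deg (d k) (f k)"
  shows "poly_deg (\<Sum>k\<in>K. d k) (\<lambda>x. \<Prod>k\<in>K. f k x)"
  using assms
  by (induction K rule: finite_induct) (auto intro: poly_deg_const poly_deg_mult)

text \<open>Each monomial becomes a product of powers of degree-one functions. The lemma is applied
  to the points \<open>u + s *\<^sub>R (z - u)\<close> of the segment from the mean to a
  node.\<close>

lemma poly_deg_affine_subst:
  fixes f :: "real ^ 'n \<Rightarrow> real"
  assumes "poly_deg d f"
  shows "poly_deg d (\<lambda>x. f (a + s *\<^sub>R (x - b)))"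
proof -
  obtain c where c: "\<And>x. f x = (\<Sum>\<alpha>\<in>exponents d. c \<alpha> * monomial_fun \<alpha> x)"
    using assms unfolding poly_deg_def by blast
  have "poly_deg d (\<lambda>x. monomial_fun \<alpha> (a + s *\<^sub>R (x - b)))" if "\<alpha> \<in> exponents d" for \<alpha>
  proof (rule poly_deg_mono)
    have "poly_deg (\<Sum>i\<in>UNIV. \<alpha> i * 1) (\<lambda>x. \<Prod>i\<in>UNIV. ((a $ i - s * b $ i) + s * x $ i) ^ \<alpha> i)"
      by (intro poly_deg_prod poly_deg_power poly_deg_affine_coord) simp
    then show "poly_deg (\<Sum>i\<in>UNIV. \<alpha> i) (\<lambda>x. monomial_fun \<alpha> (a + s *\<^sub>R (x - b)))"
      unfolding monomial_fun_def by (simp add: algebra_simps)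
    show "(\<Sum>i\<in>UNIV. \<alpha> i) \<le> d" using that by (simp add: exponents_def)
  qed
  then show ?thesis
    unfolding c by (intro poly_deg_sum poly_deg_cmult)
qed

lemma bounded_linear_coord_expansion:
  fixes f :: "real ^ 'n \<Rightarrow> real"
  assumes "bounded_linear f"
  shows "f x = (\<Sum>i\<in>UNIV. f (axis i 1) * x $ i)"
proof -
  interpret bounded_linear f by fact
  have "f x = f (\<Sum>i\<in>UNIV. x $ i *\<^sub>R axis i 1)"
    using basis_expansion[of x] by (simp add: scalar_mult_eq_scaleR)
  then show ?thesis by (simp add: sum scaleR mult.commute)
qed

lemma real_polynomial_function_imp_poly_deg:
  fixes f :: "real ^ 'n \<Rightarrow> real"
  assumes "real_polynomial_function f"
  shows "\<exists>d. poly_deg d f"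
  using assms
proof induction
  case (linear f)
  have "poly_deg 1 (\<lambda>x. \<Sum>i\<in>UNIV. f (axis i 1) * x $ i)"
    by (intro poly_deg_sum poly_deg_cmult poly_deg_coord)
  then show ?case
    using bounded_linear_coord_expansion[OF linear] by (metis (no_types, lifting) ext)
next
  case (const c)
  then show ?case using poly_deg_const by blast
next
  case (add f g)
  then obtain d e where "poly_deg d f" "poly_deg e g" by blast
  then have "poly_deg (max d e) (\<lambda>x. f x + g x)"
    by (intro poly_deg_add) (auto elim: poly_deg_mono)
  then show ?case by blast
next
  case (mult f g)
  then show ?case using poly_deg_mult by blast
qed

lemma common_poly_deg:
  fixes f :: "'k \<Rightarrow> real ^ 'n \<Rightarrow> real"
  assumes "finite K" "\<And>k. k \<in> K \<Longrightarrow> real_polynomial_function (f k)"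
  obtains d where "\<And>k. k \<in> K \<Longrightarrow> poly_deg d (f k)"
proof -
  have "\<forall>k. \<exists>d. k \<in> K \<longrightarrow> poly_deg d (f k)"
    using real_polynomial_function_imp_poly_deg assms(2) by blast
  then obtain d where d: "\<And>k. k \<in> K \<Longrightarrow> poly_deg (d k) (f k)" by metis
  show ?thesis
    by (rule that[of "\<Sum>k\<in>K. d k"]) (auto intro: poly_deg_mono[OF d] member_le_sum assms(1))
qed

subsection \<open>Evaluation functionals and moment relaxations\<close>

definition eval_comb :: "(real ^ 'n) set \<Rightarrow> (real ^ 'n \<Rightarrow> real) \<Rightarrow> (real ^ 'n \<Rightarrow> real) \<Rightarrow> real" where
  "eval_comb Z c f = (\<Sum>z\<in>Z. c z * f z)"

lemma eval_comb_add: "eval_comb Z c (\<lambda>z. f z + g z) = eval_comb Z c f + eval_comb Z c g"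
  by (simp add: eval_comb_def distrib_left sum.distrib)

lemma eval_comb_diff: "eval_comb Z c (\<lambda>z. f z - g z) = eval_comb Z c f - eval_comb Z c g"
  by (simp add: eval_comb_def right_diff_distrib sum_subtractf)

lemma eval_comb_cmult: "eval_comb Z c (\<lambda>z. a * f z) = a * eval_comb Z c f"
  by (simp add: eval_comb_def sum_distrib_left mult_ac)

lemma eval_comb_minus: "eval_comb Z c (\<lambda>z. - f z) = - eval_comb Z c f"
  using eval_comb_cmult[of Z c "-1" f] by simp

lemma eval_comb_sum: "eval_comb Z c (\<lambda>z. \<Sum>k\<in>K. f k z) = (\<Sum>k\<in>K. eval_comb Z c (f k))"
  unfolding eval_comb_def by (simp add: sum_distrib_left) (rule sum.swap)

lemma eval_comb_const: "eval_comb Z c (\<lambda>z. a) = a * eval_comb Z c (\<lambda>z. 1)"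
  using eval_comb_cmult[of Z c a "\<lambda>_. 1"] by simp

lemmas eval_comb_linear = eval_comb_add eval_comb_diff eval_comb_cmult eval_comb_minus eval_comb_sum

text \<open>By induction on the number of functions: either the old nodes still suffice, or one
  further node does.\<close>

lemma unisolvent_nodes_finite:
  fixes f :: "'t \<Rightarrow> real ^ 'n \<Rightarrow> real"
  assumes "finite T"
  shows "\<exists>Z. finite Z \<and> (\<forall>x. \<exists>c. \<forall>t\<in>T. eval_comb Z c (f t) = f t x)"
  using assms
proof (induction T rule: finite_induct)
  case empty
  then show ?case by (intro exI[of _ "{}"]) simp
next
  case (insert t0 T)
  then obtain Z where Z: "finite Z" "\<And>x. \<exists>c. \<forall>t\<in>T. eval_comb Z c (f t) = f t x" by blast
  show ?case
  proof (cases "\<forall>x. \<exists>c. \<forall>t\<in>insert t0 T. eval_comb Z c (f t) = f t x")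
    case True
    then show ?thesis using Z(1) by blast
  next
    case False
    then obtain x0 where x0: "\<And>c. \<exists>t\<in>insert t0 T. eval_comb Z c (f t) \<noteq> f t x0" by blast
    obtain c0 where c0: "\<And>t. t \<in> T \<Longrightarrow> eval_comb Z c0 (f t) = f t x0" using Z(2) by blast
    define r0 where "r0 = f t0 x0 - eval_comb Z c0 (f t0)"
    have "r0 \<noteq> 0" using x0[of c0] c0 by (auto simp: r0_def)
    have "x0 \<notin> Z"
    proof
      assume "x0 \<in> Z"
      then have "eval_comb Z (\<lambda>z. if z = x0 then 1 else 0) g = g x0" for g
        using Z(1) by (simp add: eval_comb_def mult_delta_left)
      then show False using x0 by blast
    qed
    show ?thesis
    proof (intro exI[of _ "insert x0 Z"] conjI allI)
      show "finite (insert x0 Z)" using Z(1) by simp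
      fix x
      obtain c where c: "\<And>t. t \<in> T \<Longrightarrow> eval_comb Z c (f t) = f t x" using Z(2) by blast
      \<comment> \<open>Evaluation at \<open>x0\<close> minus the combination \<open>c0\<close>
        vanishes on all \<open>f t\<close> with \<open>t\<close> in \<open>T\<close> and equals
        \<open>r0\<close> on \<open>f t0\<close>. Adding \<open>r\<close> times it corrects the
        value on \<open>f t0\<close> alone.\<close>
      define r where "r = (f t0 x - eval_comb Z c (f t0)) / r0"
      define b where "b z = (if z = x0 then r else c z - r * c0 z)" for z
      have b: "eval_comb (insert x0 Z) b g = eval_comb Z c g + r * (g x0 - eval_comb Z c0 g)" for g
      proof -
        have "(\<Sum>z\<in>Z. b z * g z) = (\<Sum>z\<in>Z. c z * g z - r * (c0 z * g z))"
          using \<open>x0 \<notin> Z\<close> by (intro sum.cong) (auto simp: b_def algebra_simps)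
        then show ?thesis
          using Z(1) \<open>x0 \<notin> Z\<close>
          by (simp add: eval_comb_def sum_subtractf sum_distrib_left[symmetric] algebra_simps)
            (simp add: b_def)
      qed
      have "eval_comb (insert x0 Z) b (f t) = f t x" if "t \<in> insert t0 T" for t
        using that c c0 \<open>r0 \<noteq> 0\<close> unfolding b by (auto simp: r_def r0_def[symmetric])
      then show "\<exists>c. \<forall>t\<in>insert t0 T. eval_comb (insert x0 Z) c (f t) = f t x" by blast
    qed
  qed
qed

text \<open>One finite node set serves all points, only the weights depend on \<open>x\<close>; by
  linearity it is enough to match monomials. Thus weights on fixed nodes can play the role of a
  truncated moment vector.\<close>

lemma unisolvent_nodes:
  "\<exists>Z :: (real ^ 'n) set. finite Z \<and> (\<forall>x. \<exists>c. \<forall>f. poly_deg d f \<longrightarrow> eval_comb Z c f = f x)"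
proof -
  obtain Z :: "(real ^ 'n) set" where Z: "finite Z"
    "\<And>x. \<exists>c. \<forall>\<alpha>\<in>exponents d. eval_comb Z c (monomial_fun \<alpha>) = monomial_fun \<alpha> x"
    using unisolvent_nodes_finite[of "exponents d" monomial_fun] by auto
  have "\<exists>c. \<forall>f. poly_deg d f \<longrightarrow> eval_comb Z c f = f x" for x
  proof -
    obtain c where c: "\<And>\<alpha>. \<alpha> \<in> exponents d \<Longrightarrow> eval_comb Z c (monomial_fun \<alpha>) = monomial_fun \<alpha> x"
      using Z(2) by blast
    have "eval_comb Z c f = f x" if f: "poly_deg d f" for f
    proof -
      obtain a where a: "f = (\<lambda>x. \<Sum>\<alpha>\<in>exponents d. a \<alpha> * monomial_fun \<alpha> x)"
        using f unfolding poly_deg_def by blast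
      show ?thesis unfolding a by (simp add: eval_comb_linear c)
    qed
    then show ?thesis by blast
  qed
  then show ?thesis using Z(1) by blast
qed

text \<open>Quantifying over \<open>f\<close> is quantifying over its coefficient vector, so the
  condition says that the localizing matrix with entries \<open>L (w x^(\<alpha>+\<beta>))\<close>
  is positive semidefinite; these entries are linear in the weights \<open>c\<close>.\<close>

lemma LMI_localizing:
  fixes w :: "real ^ 'n \<Rightarrow> real"
  assumes "finite Z"
  shows "LMI Z (\<lambda>x c. \<forall>f. poly_deg d f \<longrightarrow> 0 \<le> eval_comb Z c (\<lambda>z. w z * (f z)\<^sup>2))"
proof (rule LMI_finite_index[of Z "exponents d :: ('n \<Rightarrow> nat) set"
      "\<lambda>\<alpha> \<beta> x c. \<Sum>z\<in>Z. c z * (w z * (monomial_fun \<alpha> z * monomial_fun \<beta> z))"])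
  fix x :: "real ^ 'n" and c
  have form: "(\<Sum>\<alpha>\<in>exponents d. \<Sum>\<beta>\<in>exponents d.
      v \<alpha> * (\<Sum>z\<in>Z. c z * (w z * (monomial_fun \<alpha> z * monomial_fun \<beta> z))) * v \<beta>) =
      eval_comb Z c (\<lambda>z. w z * (\<Sum>\<alpha>\<in>exponents d. v \<alpha> * monomial_fun \<alpha> z)\<^sup>2)" (is "?l v = ?r v") for v
  proof -
    have "eval_comb Z c (\<lambda>z. w z * (\<Sum>\<alpha>\<in>exponents d. v \<alpha> * monomial_fun \<alpha> z)\<^sup>2) =
        eval_comb Z c (\<lambda>z. \<Sum>\<alpha>\<in>exponents d. \<Sum>\<beta>\<in>exponents d.
          (v \<alpha> * v \<beta>) * (w z * (monomial_fun \<alpha> z * monomial_fun \<beta> z)))"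
      by (simp add: power2_eq_square sum_product sum_distrib_left mult_ac)
    also have "\<dots> = ?l v"
      by (simp only: eval_comb_sum eval_comb_cmult) (simp add: eval_comb_def mult_ac)
    finally show ?thesis ..
  qed
  show "(\<forall>f. poly_deg d f \<longrightarrow> 0 \<le> eval_comb Z c (\<lambda>z. w z * (f z)\<^sup>2)) \<longleftrightarrow> (\<forall>v. 0 \<le> ?l v)"
  proof
    assume *: "\<forall>f. poly_deg d f \<longrightarrow> 0 \<le> eval_comb Z c (\<lambda>z. w z * (f z)\<^sup>2)"
    show "\<forall>v. 0 \<le> ?l v"
      unfolding form
      by (intro allI *[rule_format] poly_deg_sum poly_deg_cmult poly_deg_monomial)
  next
    assume *: "\<forall>v. 0 \<le> ?l v"
    show "\<forall>f. poly_deg d f \<longrightarrow> 0 \<le> eval_comb Z c (\<lambda>z. w z * (f z)\<^sup>2)"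
    proof (intro allI impI)
      fix f :: "real ^ 'n \<Rightarrow> real" assume "poly_deg d f"
      then obtain a where a: "f = (\<lambda>x. \<Sum>\<alpha>\<in>exponents d. a \<alpha> * monomial_fun \<alpha> x)"
        unfolding poly_deg_def by blast
      show "0 \<le> eval_comb Z c (\<lambda>z. w z * (f z)\<^sup>2)"
        unfolding a using *[unfolded form] by blast
    qed
  qed
next
  show "affine_expr Z (\<lambda>x c. \<Sum>z\<in>Z. c z * (w z * (monomial_fun \<alpha> z * monomial_fun \<beta> z)))" for \<alpha> \<beta>
    using assms by (intro affine_expr_sum affine_expr_mult affine_expr_var)
qed (simp_all add: assms)

text \<open>The relaxation contains \<open>K\<close> because evaluation at a point of
  \<open>K\<close> satisfies every constraint; \<open>exact\<close> supplies the converse. It ranges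
  over all finite \<open>Z\<close>, since the nodes are chosen only after the degrees in
  \<open>W\<close>.\<close>

lemma SDP_representable_moment_relaxation:
  fixes K :: "(real ^ 'n) set" and W :: "((real ^ 'n \<Rightarrow> real) \<times> nat) set"
  assumes "finite W" and poly: "\<And>w d. (w, d) \<in> W \<Longrightarrow> real_polynomial_function w"
    and K: "\<And>x w d. x \<in> K \<Longrightarrow> (w, d) \<in> W \<Longrightarrow> 0 \<le> w x"
    and exact: "\<And>Z c x. finite Z \<Longrightarrow> eval_comb Z c (\<lambda>_. 1) = 1 \<Longrightarrow>
      (\<And>i. eval_comb Z c (\<lambda>z. z $ i) = x $ i) \<Longrightarrow>
      (\<And>w d f. (w, d) \<in> W \<Longrightarrow> poly_deg d f \<Longrightarrow> 0 \<le> eval_comb Z c (\<lambda>z. w z * (f z)\<^sup>2)) \<Longrightarrow> x \<in> K"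
  shows "SDP_representable K"
proof -
  obtain e where e: "\<And>p. p \<in> W \<Longrightarrow> poly_deg e (fst p)"
    using common_poly_deg[of W fst] assms(1) poly by (metis prod.collapse)
  \<comment> \<open>\<open>D\<close> dominates the degree of every \<open>w * f\<^sup>2\<close>
    tested in \<open>W\<close> and, through \<open>Suc\<close>, that of the coordinates.\<close>
  define D where "D = Suc (e + (\<Sum>p\<in>W. snd p + snd p))"
  obtain Z :: "(real ^ 'n) set" where Z: "finite Z"
    "\<And>x. \<exists>c. \<forall>f. poly_deg D f \<longrightarrow> eval_comb Z c f = f x"
    using unisolvent_nodes[of D] by blast
  define P where "P x c \<longleftrightarrow> (\<Sum>z\<in>Z. c z * 1) = 1 \<and> (\<forall>i\<in>UNIV. (\<Sum>z\<in>Z. c z * z $ i) = x $ i) \<and>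
      (\<forall>p\<in>W. \<forall>f. poly_deg (snd p) f \<longrightarrow> 0 \<le> eval_comb Z c (\<lambda>z. fst p z * (f z)\<^sup>2))"
    for x :: "real ^ 'n" and c
  have "LMI Z P"
    unfolding P_def
    by (intro LMI_conj LMI_ball LMI_localizing LMI_eq affine_expr_sum affine_expr_mult
        affine_expr_var affine_expr_const affine_expr_coord Z(1) assms(1) finite_class.finite_UNIV)
  then have "SDP_representable {x. \<exists>c. P x c}" by (rule SDP_representable_LMI)
  also have "{x. \<exists>c. P x c} = K"
  proof (intro set_eqI iffI)
    fix x assume "x \<in> {x. \<exists>c. P x c}"
    then obtain c where P: "P x c" by blast
    show "x \<in> K"
    proof (rule exact[OF Z(1)])
      show "eval_comb Z c (\<lambda>_. 1) = 1" "eval_comb Z c (\<lambda>z. z $ i) = x $ i" for i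
        using P by (simp_all add: P_def eval_comb_def)
      show "0 \<le> eval_comb Z c (\<lambda>z. w z * (f z)\<^sup>2)" if "(w, d) \<in> W" "poly_deg d f" for w d f
        using P that unfolding P_def by force
    qed
  next
    fix x assume "x \<in> K"
    obtain c where c: "\<And>f. poly_deg D f \<Longrightarrow> eval_comb Z c f = f x" using Z(2) by blast
    have "P x c"
      unfolding P_def
    proof (intro conjI ballI allI impI)
      show "(\<Sum>z\<in>Z. c z * 1) = 1"
        using c[OF poly_deg_const[of D 1]] by (simp add: eval_comb_def)
      show "(\<Sum>z\<in>Z. c z * z $ i) = x $ i" for i
        using c[OF poly_deg_mono[OF poly_deg_coord[of i]]] by (simp add: eval_comb_def D_def)
      fix p and f :: "real ^ 'n \<Rightarrow> real" assume p: "p \<in> W" and f: "poly_deg (snd p) f"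
      have "snd p + snd p \<le> (\<Sum>p\<in>W. snd p + snd p)"
        by (rule member_le_sum[OF p]) (simp_all add: assms(1))
      then have "poly_deg D (\<lambda>z. fst p z * (f z * f z))"
        by (intro poly_deg_mono[OF poly_deg_mult[OF e[OF p] poly_deg_mult[OF f f]]])
          (simp add: D_def)
      then have "eval_comb Z c (\<lambda>z. fst p z * (f z)\<^sup>2) = fst p x * (f x)\<^sup>2"
        using c by (simp add: power2_eq_square)
      also have "\<dots> \<ge> 0" using K[OF \<open>x \<in> K\<close>, of "fst p" "snd p"] p by simp
      finally show "0 \<le> eval_comb Z c (\<lambda>z. fst p z * (f z)\<^sup>2)" .
    qed
    then show "x \<in> {x. \<exists>c. P x c}" by blast
  qed
  finally show ?thesis .
qed

subsection \<open>Gradients and Hessians of polynomials\<close>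

lemma gradient_eqI:
  assumes "(f has_derivative (\<lambda>v. v \<bullet> a)) (at x)"
  shows "gradient f x = a"
proof -
  have "frechet_derivative f (at x) = (\<lambda>v. v \<bullet> a)"
    using frechet_derivative_at[OF assms] ..
  then show ?thesis by (simp add: gradient_def vec_eq_iff inner_axis')
qed

lemma has_derivative_gradient:
  assumes "f differentiable at x"
  shows "(f has_derivative (\<lambda>v. v \<bullet> gradient f x)) (at x)"
proof -
  have d: "(f has_derivative frechet_derivative f (at x)) (at x)"
    using assms frechet_derivative_works by blast
  have "frechet_derivative f (at x) v = v \<bullet> gradient f x" for v
    using bounded_linear_coord_expansion[OF has_derivative_bounded_linear[OF d], of v]
    by (simp add: inner_vec_def gradient_def mult.commute)
  then have "frechet_derivative f (at x) = (\<lambda>v. v \<bullet> gradient f x)" by blast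
  with d show ?thesis by simp
qed

text \<open>Both claims share one induction, since the product rule for the gradient uses
  differentiability of the factors.\<close>

lemma real_polynomial_function_gradient:
  fixes f :: "real ^ 'n \<Rightarrow> real"
  assumes "real_polynomial_function f"
  shows "f differentiable at x \<and> real_polynomial_function (\<lambda>x. gradient f x $ i)"
  using assms
proof (induction arbitrary: x)
  case (linear f)
  have "f v = v \<bullet> (\<chi> i. f (axis i 1))" for v
    using bounded_linear_coord_expansion[OF linear, of v] by (simp add: inner_vec_def mult.commute)
  then have "f = (\<lambda>v. v \<bullet> (\<chi> i. f (axis i 1)))" by blast
  moreover have d: "(f has_derivative f) (at x)" for x
    using linear by (rule bounded_linear_imp_has_derivative)
  ultimately have "gradient f x = (\<chi> i. f (axis i 1))" for x
    by (intro gradient_eqI) metis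
  then show ?case using d by (auto simp: differentiable_def)
next
  case (const c)
  have "((\<lambda>x. c) has_derivative (\<lambda>v. v \<bullet> 0)) (at x)" for x :: "real ^ 'n" by simp
  then have "gradient (\<lambda>x. c) x = 0" for x :: "real ^ 'n" by (rule gradient_eqI)
  then show ?case by auto
next
  case (add f g)
  have "((\<lambda>x. f x + g x) has_derivative (\<lambda>v. v \<bullet> (gradient f x + gradient g x))) (at x)" for x
    unfolding inner_add_right using add by (intro has_derivative_add has_derivative_gradient) auto
  from this[THEN gradient_eqI] show ?case using add by auto
next
  case (mult f g)
  have "((\<lambda>x. f x * g x) has_derivative (\<lambda>v. v \<bullet> (f x *\<^sub>R gradient g x + g x *\<^sub>R gradient f x))) (at x)"
    for x
    using mult
    by (auto intro!: derivative_eq_intros has_derivative_gradient simp: inner_add_right)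
  note grad = this[THEN gradient_eqI]
  have "real_polynomial_function (\<lambda>x. f x * gradient g x $ i + g x * gradient f x $ i)"
    using mult by (intro real_polynomial_function.intros(3,4)) blast+
  then show ?case using mult by (auto simp: grad)
qed

lemmas real_polynomial_differentiable = real_polynomial_function_gradient[THEN conjunct1]
lemmas real_polynomial_gradient = real_polynomial_function_gradient[THEN conjunct2]

lemma has_derivative_gradient_hessian:
  fixes f :: "real ^ 'n \<Rightarrow> real"
  assumes "real_polynomial_function f"
  shows "(gradient f has_derivative (\<lambda>v. hessian f x *v v)) (at x)"
proof -
  have "((\<lambda>x. gradient f x \<bullet> b) differentiable at x)" if "b \<in> Basis" for b
  proof -
    obtain i where "b = axis i 1" using \<open>b \<in> Basis\<close> by (auto simp: Basis_vec_def)
    then show ?thesis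
      using real_polynomial_differentiable[OF real_polynomial_gradient[OF assms]]
      by (simp add: inner_axis)
  qed
  then have "gradient f differentiable at x"
    using differentiable_componentwise_within by blast
  then show ?thesis unfolding hessian_def jacobian_works .
qed

lemma hessian_nth:
  assumes "real_polynomial_function f"
  shows "hessian f x $ i $ j = gradient (\<lambda>x. gradient f x $ i) x $ j"
proof -
  have "((\<lambda>x. gradient f x $ i) has_derivative (\<lambda>v. (hessian f x *v v) $ i)) (at x)"
    by (rule bounded_linear.has_derivative[OF bounded_linear_vec_nth
        has_derivative_gradient_hessian[OF assms]])
  moreover have "(hessian f x *v v) $ i = v \<bullet> hessian f x $ i" for v
    by (simp add: matrix_vector_mul_component inner_commute)
  ultimately have "gradient (\<lambda>x. gradient f x $ i) x = hessian f x $ i"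
    by (intro gradient_eqI) simp
  then show ?thesis by simp
qed

lemma real_polynomial_hessian:
  assumes "real_polynomial_function f"
  shows "real_polynomial_function (\<lambda>x. hessian f x $ i $ j)"
  unfolding hessian_nth[OF assms] by (intro real_polynomial_gradient assms)

subsection \<open>Jensen's inequality for pseudo-moments\<close>

text \<open>The function \<open>s \<mapsto> L (z \<mapsto> p (u + s (z - u)))\<close> is concave on \<open>[0, 1]\<close> with vanishing
  derivative at \<open>0\<close>.\<close>

lemma eval_comb_Jensen:
  fixes p :: "real ^ 'n \<Rightarrow> real"
  assumes p: "real_polynomial_function p"
    and one: "eval_comb Z c (\<lambda>_. 1) = 1" and mean: "\<And>i. eval_comb Z c (\<lambda>z. z $ i) = u $ i"
    and concave: "\<And>s. 0 \<le> s \<Longrightarrow> s \<le> 1 \<Longrightarrow>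
      0 \<le> eval_comb Z c (\<lambda>z. - ((z - u) \<bullet> (hessian p (u + s *\<^sub>R (z - u)) *v (z - u))))"
  shows "eval_comb Z c p \<le> p u"
proof -
  define h0 where "h0 s = eval_comb Z c (\<lambda>z. p (u + s *\<^sub>R (z - u)))" for s
  define h1 where "h1 s = eval_comb Z c (\<lambda>z. (z - u) \<bullet> gradient p (u + s *\<^sub>R (z - u)))" for s
  define h2 where "h2 s = eval_comb Z c (\<lambda>z. (z - u) \<bullet> (hessian p (u + s *\<^sub>R (z - u)) *v (z - u)))" for s
  have line: "((\<lambda>s. u + s *\<^sub>R v) has_derivative (\<lambda>t. t *\<^sub>R v)) (at s)" for v s
    by (auto intro!: derivative_eq_intros)
  have d0: "DERIV h0 s :> h1 s" for s
  proof -
    have "((\<lambda>s. p (u + s *\<^sub>R v)) has_derivative (\<lambda>t. t *\<^sub>R v \<bullet> gradient p (u + s *\<^sub>R v))) (at s)" for v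
      by (rule has_derivative_compose[OF line has_derivative_gradient])
        (rule real_polynomial_differentiable[OF p])
    then have "((\<lambda>s. p (u + s *\<^sub>R v)) has_field_derivative (v \<bullet> gradient p (u + s *\<^sub>R v))) (at s)" for v
      by (simp add: has_field_derivative_def mult_commute_abs)
    then show ?thesis
      unfolding h0_def h1_def eval_comb_def by (intro DERIV_sum DERIV_cmult)
  qed
  have d1: "DERIV h1 s :> h2 s" for s
  proof -
    have "((\<lambda>s. v \<bullet> gradient p (u + s *\<^sub>R v)) has_derivative
        (\<lambda>t. v \<bullet> (hessian p (u + s *\<^sub>R v) *v (t *\<^sub>R v)))) (at s)" for v
      by (rule has_derivative_inner_right,
          rule has_derivative_compose[OF line has_derivative_gradient_hessian[OF p]])
    then have "((\<lambda>s. v \<bullet> gradient p (u + s *\<^sub>R v)) has_field_derivative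
        (v \<bullet> (hessian p (u + s *\<^sub>R v) *v v))) (at s)" for v
      by (simp add: has_field_derivative_def mult_commute_abs matrix_vector_mult_scaleR)
    then show ?thesis
      unfolding h1_def h2_def eval_comb_def by (intro DERIV_sum DERIV_cmult)
  qed
  \<comment> \<open>Every order from 2 on is filled with \<open>h2\<close>; the expansion to order 2
    has the Lagrange remainder \<open>h2 t / 2\<close>.\<close>
  define diff where "diff m = (if m = 0 then h0 else if m = 1 then h1 else h2)" for m :: nat
  have "\<exists>t>0. t < 1 \<and> h0 1 = (\<Sum>m<2. diff m 0 / fact m * 1 ^ m) + diff 2 t / fact 2 * 1\<^sup>2"
    by (rule Maclaurin) (auto simp: diff_def less_2_cases_iff d0 d1)
  then obtain t where t: "0 < t" "t < 1" "h0 1 = h0 0 + h1 0 + h2 t / 2"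
    by (auto simp: diff_def numeral_2_eq_2)
  \<comment> \<open>The first-order term is a linear combination of the centred coordinates, which
    \<open>L\<close> sends to zero because \<open>u\<close> is the mean.\<close>
  have "h1 0 = (\<Sum>i\<in>UNIV. gradient p u $ i * eval_comb Z c (\<lambda>z. z $ i - u $ i))"
    unfolding h1_def eval_comb_cmult[symmetric] eval_comb_sum[symmetric]
    by (simp add: inner_vec_def mult.commute)
  also have "\<dots> = 0"
    by (simp add: eval_comb_diff eval_comb_const[of _ _ "u $ _"] one mean)
  finally have "h1 0 = 0" .
  moreover have "h2 t \<le> 0"
    using concave[of t] t by (simp add: h2_def eval_comb_minus)
  moreover have "h0 0 = p u" using eval_comb_const[of Z c "p u"] one by (simp add: h0_def)
  moreover have "h0 1 = eval_comb Z c p" by (simp add: h0_def)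
  ultimately show ?thesis using t(3) by simp
qed

section \<open>Quadratic forms as sums of squares, and exactness in the sos-convex case\<close>

lemma quadratic_form_expand:
  fixes A :: "real ^ 'n ^ 'n"
  shows "v \<bullet> (A *v v) = (\<Sum>i\<in>UNIV. \<Sum>j\<in>UNIV. v $ i * v $ j * A $ i $ j)"
  by (simp add: inner_vec_def matrix_vector_mult_def sum_distrib_left mult_ac)

lemma sum_of_squares_form:
  fixes w :: "'i::finite \<Rightarrow> real"
  shows "(\<Sum>i\<in>UNIV. \<Sum>j\<in>UNIV. v i * v j * (\<Sum>l\<in>K. w' l i * w' l j)) =
    (\<Sum>l\<in>K. (\<Sum>i\<in>UNIV. w' l i * (v i :: real))\<^sup>2)"
proof -
  have "(\<Sum>l\<in>K. (\<Sum>i\<in>UNIV. w' l i * v i)\<^sup>2) =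
      (\<Sum>l\<in>K. \<Sum>i\<in>UNIV. \<Sum>j\<in>UNIV. v i * v j * (w' l i * w' l j))"
    by (simp add: power2_eq_square sum_product mult_ac)
  also have "\<dots> = (\<Sum>i\<in>UNIV. \<Sum>l\<in>K. \<Sum>j\<in>UNIV. v i * v j * (w' l i * w' l j))"
    by (rule sum.swap)
  also have "\<dots> = (\<Sum>i\<in>UNIV. \<Sum>j\<in>UNIV. \<Sum>l\<in>K. v i * v j * (w' l i * w' l j))"
    by (rule sum.cong[OF refl]) (rule sum.swap)
  finally show ?thesis by (simp add: sum_distrib_left)
qed

text \<open>At every point of the segment the second-order term is a sum of squares of polynomials
  in \<open>z\<close> of bounded degree, so Jensen's inequality applies. Then
  \<open>0 \<le> L g \<le> g u\<close> puts the mean into the set.\<close>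

lemma sos_convex_SDP_representable:
  fixes g :: "real ^ 'n \<Rightarrow> real"
  assumes "sos_convex g"
  shows "SDP_representable (superlevel g)"
proof -
  have g: "real_polynomial_function g" using assms by (simp add: sos_convex_def)
  obtain k :: nat and W :: "nat \<Rightarrow> 'n \<Rightarrow> real ^ 'n \<Rightarrow> real" where
    W: "\<And>l i. l < k \<Longrightarrow> real_polynomial_function (W l i)"
    and H: "\<And>x i j. - hessian g x $ i $ j = (\<Sum>l<k. W l i x * W l j x)"
    using assms unfolding sos_convex_def SOS_matrix_def by auto
  obtain d where "\<And>q. q \<in> {..<k} \<times> UNIV \<Longrightarrow> poly_deg d (W (fst q) (snd q))"
    by (rule common_poly_deg[of "{..<k} \<times> UNIV" "\<lambda>q. W (fst q) (snd q)"]) (use W in auto)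
  then have d: "poly_deg d (W l i)" if "l < k" for l i
    using that by (metis SigmaI UNIV_I fst_conv lessThan_iff snd_conv)
  show ?thesis
  \<comment> \<open>Degree \<open>d + 1\<close> accommodates an entry of \<open>W\<close> times a
    coordinate \<open>z $ i - u $ i\<close>. The pair \<open>(g, 0)\<close> tests \<open>g\<close>
    against constants only, which amounts to \<open>L g \<ge> 0\<close>.\<close>
  proof (rule SDP_representable_moment_relaxation[of "{(\<lambda>_. 1, d + 1), (g, 0)}"])
    show "real_polynomial_function w" if "(w, e) \<in> {(\<lambda>_. 1, d + 1), (g, 0)}" for w e
      using that g by auto
    show "0 \<le> w x" if "x \<in> superlevel g" "(w, e) \<in> {(\<lambda>_. 1, d + 1), (g, 0)}" for x w e
      using that by (auto simp: superlevel_def)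
  next
    fix Z c and u :: "real ^ 'n"
    assume one: "eval_comb Z c (\<lambda>_. 1) = 1" and mean: "\<And>i. eval_comb Z c (\<lambda>z. z $ i) = u $ i"
      and pos: "\<And>w e f. (w, e) \<in> {(\<lambda>_. 1, d + 1), (g, 0)} \<Longrightarrow> poly_deg e f \<Longrightarrow>
        0 \<le> eval_comb Z c (\<lambda>z. w z * (f z)\<^sup>2)"
    have "eval_comb Z c g \<le> g u"
    proof (rule eval_comb_Jensen[OF g one mean])
      fix s :: real
      have "- ((z - u) \<bullet> (hessian g (u + s *\<^sub>R (z - u)) *v (z - u))) =
          (\<Sum>l<k. (\<Sum>i\<in>UNIV. W l i (u + s *\<^sub>R (z - u)) * (z $ i - u $ i))\<^sup>2)" for z
        unfolding sum_of_squares_form[symmetric] H[symmetric] quadratic_form_expand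
        by (simp add: sum_negf)
      then have "eval_comb Z c (\<lambda>z. - ((z - u) \<bullet> (hessian g (u + s *\<^sub>R (z - u)) *v (z - u)))) =
          (\<Sum>l<k. eval_comb Z c (\<lambda>z. (\<Sum>i\<in>UNIV. W l i (u + s *\<^sub>R (z - u)) * (z $ i - u $ i))\<^sup>2))"
        by (simp add: eval_comb_sum)
      also have "\<dots> \<ge> 0"
      proof (rule sum_nonneg)
        fix l assume "l \<in> {..<k}"
        then have "poly_deg d (\<lambda>z. W l i (u + s *\<^sub>R (z - u)))" for i
          by (intro poly_deg_affine_subst[OF d]) simp
        then have "poly_deg (d + 1) (\<lambda>z. \<Sum>i\<in>UNIV. W l i (u + s *\<^sub>R (z - u)) * (z $ i - u $ i))"
          by (intro poly_deg_sum poly_deg_mult poly_deg_diff poly_deg_coord poly_deg_const)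
        then show "0 \<le> eval_comb Z c (\<lambda>z. (\<Sum>i\<in>UNIV. W l i (u + s *\<^sub>R (z - u)) * (z $ i - u $ i))\<^sup>2)"
          using pos[of "\<lambda>_. 1" "d + 1"] by simp
      qed
      finally show "0 \<le> eval_comb Z c (\<lambda>z. - ((z - u) \<bullet> (hessian g (u + s *\<^sub>R (z - u)) *v (z - u))))" .
    qed
    moreover have "0 \<le> eval_comb Z c g"
      using pos[of g 0 "\<lambda>_. 1"] by (simp add: poly_deg_const)
    ultimately show "u \<in> superlevel g" by (simp add: superlevel_def)
  qed simp
qed

subsection \<open>Positive definite forms\<close>

text \<open>Cholesky factorisation, splitting off one index at a time by its Schur complement.\<close>

lemma positive_definite_imp_sum_of_squares:
  fixes A :: "'i \<Rightarrow> 'i \<Rightarrow> real"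
  assumes "finite I" "\<And>a b. a \<in> I \<Longrightarrow> b \<in> I \<Longrightarrow> A a b = A b a"
    and "\<And>v. \<exists>a\<in>I. v a \<noteq> 0 \<Longrightarrow> 0 < (\<Sum>a\<in>I. \<Sum>b\<in>I. v a * A a b * v b)"
  shows "\<exists>(k::nat) w. \<forall>a\<in>I. \<forall>b\<in>I. A a b = (\<Sum>l<k. w l a * w l b)"
  using assms
proof (induction I arbitrary: A rule: finite_induct)
  case empty
  then show ?case by simp
next
  case (insert c I)
  have expand: "(\<Sum>a\<in>insert c I. \<Sum>b\<in>insert c I. v a * A a b * v b) =
      v c * v c * A c c + 2 * v c * (\<Sum>b\<in>I. A c b * v b) + (\<Sum>a\<in>I. \<Sum>b\<in>I. v a * A a b * v b)" for v
  proof -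
    have "(\<Sum>a\<in>I. v a * A a c * v c) = v c * (\<Sum>b\<in>I. A c b * v b)"
      using insert.prems(1) by (simp add: sum_distrib_left mult_ac cong: sum.cong)
    moreover have "(\<Sum>b\<in>I. v c * A c b * v b) = v c * (\<Sum>b\<in>I. A c b * v b)"
      by (simp add: sum_distrib_left mult_ac)
    ultimately show ?thesis
      using insert.hyps by (simp add: sum.distrib algebra_simps)
  qed
  have "0 < A c c"
  proof -
    have "(\<Sum>b\<in>I. A c b * (if b = c then 1 else 0)) = 0"
      "(\<Sum>a\<in>I. \<Sum>b\<in>I. (if a = c then 1 else 0) * A a b * (if b = c then 1 else 0)) = 0"
      using insert.hyps by (auto intro!: sum.neutral)
    then show ?thesis
      using insert.prems(2)[of "\<lambda>a. if a = c then 1 else 0"] unfolding expand by simp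
  qed
  define B where "B a b = A a b - A a c * A c b / A c c" for a b
  have B: "(\<Sum>a\<in>I. \<Sum>b\<in>I. v a * B a b * v b) =
      (\<Sum>a\<in>I. \<Sum>b\<in>I. v a * A a b * v b) - (\<Sum>b\<in>I. A c b * v b)\<^sup>2 / A c c" for v
  proof -
    have "(\<Sum>b\<in>I. A c b * v b)\<^sup>2 / A c c = (\<Sum>a\<in>I. \<Sum>b\<in>I. v a * (A a c * A c b / A c c) * v b)"
      unfolding power2_eq_square sum_product sum_divide_distrib
      using insert.prems(1) by (intro sum.cong refl) simp
    then show ?thesis
      by (simp add: B_def algebra_simps sum_subtractf)
  qed
  have "\<exists>(k::nat) w. \<forall>a\<in>I. \<forall>b\<in>I. B a b = (\<Sum>l<k. w l a * w l b)"
  proof (rule insert.IH)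
    show "B a b = B b a" if "a \<in> I" "b \<in> I" for a b
      using that insert.prems(1)[of a b] insert.prems(1)[of a c] insert.prems(1)[of b c]
      by (simp add: B_def)
    fix v :: "'i \<Rightarrow> real" assume v: "\<exists>a\<in>I. v a \<noteq> 0"
    define S where "S = (\<Sum>b\<in>I. A c b * v b)"
    \<comment> \<open>Extending \<open>v\<close> by the minimiser in coordinate \<open>c\<close>
      completes the square, so the full form takes the value of the Schur complement
      \<open>B\<close> at \<open>v\<close>.\<close>
    define v' where "v' = v(c := - S / A c c)"
    have v'I: "v' a = v a" if "a \<in> I" for a using that insert.hyps by (auto simp: v'_def)
    have "0 < (\<Sum>a\<in>insert c I. \<Sum>b\<in>insert c I. v' a * A a b * v' b)"
      using v v'I by (intro insert.prems(2)) auto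
    also have "\<dots> = v' c * v' c * A c c + 2 * v' c * S + (\<Sum>a\<in>I. \<Sum>b\<in>I. v a * A a b * v b)"
      unfolding expand S_def by (simp add: v'I cong: sum.cong)
    also have "\<dots> = (\<Sum>a\<in>I. \<Sum>b\<in>I. v a * B a b * v b)"
      using \<open>0 < A c c\<close> unfolding B S_def[symmetric] v'_def by (simp add: field_simps power2_eq_square)
    finally show "0 < (\<Sum>a\<in>I. \<Sum>b\<in>I. v a * B a b * v b)" .
  qed
  then obtain k :: nat and w where w: "\<And>a b. a \<in> I \<Longrightarrow> b \<in> I \<Longrightarrow> B a b = (\<Sum>l<k. w l a * w l b)"
    by blast
  \<comment> \<open>The new row \<open>k\<close> is the row of the pivot divided by the root of the
    pivot. It reproduces all entries involving \<open>c\<close> and adds back the rank-one term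
    subtracted in \<open>B\<close>; the old rows are extended by zero at \<open>c\<close>.\<close>
  define w' where "w' l a = (if l = k then A c a / sqrt (A c c) else if a = c then 0 else w l a)" for l a
  have "A a b = (\<Sum>l<Suc k. w' l a * w' l b)" if ab: "a \<in> insert c I" "b \<in> insert c I" for a b
  proof -
    have "(\<Sum>l<Suc k. w' l a * w' l b) = (\<Sum>l<k. w' l a * w' l b) + A c a * A c b / A c c"
      using \<open>0 < A c c\<close> by (simp add: w'_def)
    also have "(\<Sum>l<k. w' l a * w' l b) = (if a = c \<or> b = c then 0 else B a b)"
      using ab by (auto simp: w'_def w)
    finally show ?thesis
      using \<open>0 < A c c\<close> insert.prems(1)[OF ab(1), of c] by (auto simp: B_def)
  qed
  then show ?case by blast
qed

text \<open>The minimum over the compact unit sphere is positive, and homogeneity of degree two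
  spreads it to all vectors.\<close>

lemma positive_on_sphere_imp_coercive:
  fixes q :: "'a::euclidean_space \<Rightarrow> real"
  assumes cont: "continuous_on UNIV q" and hom: "\<And>t v. q (t *\<^sub>R v) = t\<^sup>2 * q v"
    and pos: "\<And>v. norm v = 1 \<Longrightarrow> 0 < q v"
  shows "\<exists>l>0. \<forall>v. l * (norm v)\<^sup>2 \<le> q v"
proof -
  obtain w where w: "norm w = 1" "\<And>v. norm v = 1 \<Longrightarrow> q w \<le> q v"
    using continuous_attains_inf[of "sphere (0::'a) 1" q] continuous_on_subset[OF cont] by auto
  have "q w * (norm v)\<^sup>2 \<le> q v" for v
  proof (cases "v = 0")
    case True
    then show ?thesis using hom[of 0 v] by simp
  next
    case False
    have "q v = (norm v)\<^sup>2 * q (sgn v)"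
      unfolding hom[symmetric] using False by (simp add: sgn_div_norm)
    moreover have "q w \<le> q (sgn v)" using False by (intro w(2)) (simp add: norm_sgn)
    ultimately show ?thesis by (simp add: mult.commute mult_right_mono)
  qed
  then show ?thesis using pos[OF w(1)] by blast
qed

text \<open>On the unit sphere, the set where the form is nonpositive is compact and misses the
  hyperplane orthogonal to \<open>b\<close>. There \<open>(v \<bullet> b)\<^sup>2\<close> has a
  positive lower bound, so a large multiple of it outweighs the form.\<close>

lemma Finsler:
  fixes A :: "real ^ 'n ^ 'n" and b :: "real ^ 'n"
  assumes pos: "\<And>v. v \<noteq> 0 \<Longrightarrow> v \<bullet> b = 0 \<Longrightarrow> 0 < v \<bullet> (A *v v)"
  shows "\<exists>k>0. \<exists>l>0. \<forall>v. l * (norm v)\<^sup>2 \<le> v \<bullet> (A *v v) + k * (v \<bullet> b)\<^sup>2"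
proof -
  have cq: "continuous_on X (\<lambda>v. v \<bullet> (A *v v))" for X
    by (intro continuous_intros linear_continuous_on matrix_vector_mul_bounded_linear)
  obtain w where w: "\<forall>v\<in>sphere 0 1. w \<bullet> (A *v w) \<le> v \<bullet> (A *v v)"
    using continuous_attains_inf[of "sphere (0 :: real ^ 'n) 1" "\<lambda>v. v \<bullet> (A *v v)"] cq by auto
  define m where "m = w \<bullet> (A *v w)"
  have m: "m \<le> v \<bullet> (A *v v)" if "norm v = 1" for v
    using w that by (simp add: m_def)
  define C where "C = {v. v \<bullet> (A *v v) \<le> 0} \<inter> sphere 0 1"
  have "closed {v. v \<bullet> (A *v v) \<le> 0}" by (intro closed_Collect_le cq continuous_on_const)
  then have "compact C" unfolding C_def by (intro closed_Int_compact) auto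
  have "\<exists>\<mu>>0. \<forall>v\<in>C. \<mu> \<le> (v \<bullet> b)\<^sup>2"
  proof (cases "C = {}")
    case False
    have "continuous_on C (\<lambda>v. (v \<bullet> b)\<^sup>2)" by (intro continuous_intros)
    then obtain w where w: "w \<in> C" "\<forall>v\<in>C. (w \<bullet> b)\<^sup>2 \<le> (v \<bullet> b)\<^sup>2"
      using continuous_attains_inf[OF \<open>compact C\<close> False] by blast
    have "w \<bullet> b \<noteq> 0" using w(1) pos[of w] unfolding C_def by fastforce
    then show ?thesis using w(2) by (intro exI[of _ "(w \<bullet> b)\<^sup>2"]) simp
  qed (auto intro: exI[of _ 1])
  then obtain \<mu> where \<mu>: "0 < \<mu>" "\<And>v. v \<in> C \<Longrightarrow> \<mu> \<le> (v \<bullet> b)\<^sup>2" by blast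
  \<comment> \<open>\<open>m\<close> bounds the form from below on the sphere and \<mu> bounds
    \<open>(v \<bullet> b)\<^sup>2\<close> from below on \<open>C\<close>; with this
    \<open>k\<close> the sum is at least \<open>m + \<bar>m\<bar> + 1 > 0\<close> on
    \<open>C\<close>.\<close>
  define k where "k = (\<bar>m\<bar> + 1) / \<mu>"
  have "0 < k" using \<mu>(1) by (simp add: k_def)
  have "\<exists>l>0. \<forall>v. l * (norm v)\<^sup>2 \<le> v \<bullet> (A *v v) + k * (v \<bullet> b)\<^sup>2"
  proof (rule positive_on_sphere_imp_coercive)
    show "continuous_on UNIV (\<lambda>v. v \<bullet> (A *v v) + k * (v \<bullet> b)\<^sup>2)"
      by (intro continuous_intros cq)
    show "t *\<^sub>R v \<bullet> (A *v (t *\<^sub>R v)) + k * (t *\<^sub>R v \<bullet> b)\<^sup>2 =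
        t\<^sup>2 * (v \<bullet> (A *v v) + k * (v \<bullet> b)\<^sup>2)" for t v
      by (simp add: matrix_vector_mult_scaleR power2_eq_square algebra_simps)
    fix v :: "real ^ 'n" assume v: "norm v = 1"
    show "0 < v \<bullet> (A *v v) + k * (v \<bullet> b)\<^sup>2"
    proof (cases "v \<in> C")
      case True
      have "\<bar>m\<bar> + 1 = k * \<mu>" using \<mu>(1) by (simp add: k_def)
      also have "\<dots> \<le> k * (v \<bullet> b)\<^sup>2" using \<mu>(2)[OF True] \<open>0 < k\<close> by simp
      finally show ?thesis using m[OF v] by linarith
    next
      case False
      then have "0 < v \<bullet> (A *v v)" using v by (auto simp: C_def)
      then show ?thesis using \<open>0 < k\<close> by (simp add: add_pos_nonneg)
    qed
  qed
  then show ?thesis using \<open>0 < k\<close> by blast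
qed

subsection \<open>Pseudo-moments localised to a small ball\<close>

definition pseudo_moment :: "nat \<Rightarrow> (real ^ 'n) set \<Rightarrow> (real ^ 'n \<Rightarrow> real) \<Rightarrow> bool" where
  "pseudo_moment N Z c \<longleftrightarrow> (\<forall>f. poly_deg N f \<longrightarrow> 0 \<le> eval_comb Z c (\<lambda>z. (f z)\<^sup>2))"

definition ball_pseudo_moment ::
  "nat \<Rightarrow> real ^ 'n \<Rightarrow> real \<Rightarrow> (real ^ 'n) set \<Rightarrow> (real ^ 'n \<Rightarrow> real) \<Rightarrow> bool" where
  "ball_pseudo_moment N a \<delta> Z c \<longleftrightarrow> pseudo_moment N Z c \<and>
     (\<forall>f. poly_deg N f \<longrightarrow> 0 \<le> eval_comb Z c (\<lambda>z. (\<delta>\<^sup>2 - (\<Sum>i\<in>UNIV. (z $ i - a $ i)\<^sup>2)) * (f z)\<^sup>2))"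

text \<open>Multiplication by \<open>\<phi>\<close> has norm at most \<open>B\<close> with respect to the seminorm \<open>f \<mapsto> sqrt (L (f\<^sup>2))\<close>,
  on polynomials whose degree leaves room for \<open>\<phi>\<close>.\<close>

definition mult_bound ::
  "nat \<Rightarrow> (real ^ 'n) set \<Rightarrow> (real ^ 'n \<Rightarrow> real) \<Rightarrow> nat \<Rightarrow> real \<Rightarrow> (real ^ 'n \<Rightarrow> real) \<Rightarrow> bool" where
  "mult_bound N Z c D B \<phi> \<longleftrightarrow> 0 \<le> B \<and> poly_deg D \<phi> \<and>
     (\<forall>d f. d + D \<le> N \<longrightarrow> poly_deg d f \<longrightarrow>
        eval_comb Z c (\<lambda>z. (\<phi> z * f z)\<^sup>2) \<le> B\<^sup>2 * eval_comb Z c (\<lambda>z. (f z)\<^sup>2))"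

lemma pseudo_momentD:
  "pseudo_moment N Z c \<Longrightarrow> poly_deg d f \<Longrightarrow> d \<le> N \<Longrightarrow> 0 \<le> eval_comb Z c (\<lambda>z. (f z)\<^sup>2)"
  unfolding pseudo_moment_def using poly_deg_mono by blast

lemma mult_boundD:
  "mult_bound N Z c D B \<phi> \<Longrightarrow> poly_deg d f \<Longrightarrow> d + D \<le> N \<Longrightarrow>
    eval_comb Z c (\<lambda>z. (\<phi> z * f z)\<^sup>2) \<le> B\<^sup>2 * eval_comb Z c (\<lambda>z. (f z)\<^sup>2)"
  unfolding mult_bound_def by blast

lemma mult_bound_mono:
  assumes "mult_bound N Z c D B \<phi>" "B \<le> B'" "D \<le> D'" "pseudo_moment N Z c"
  shows "mult_bound N Z c D' B' \<phi>"
  unfolding mult_bound_def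
proof (intro conjI allI impI)
  show "0 \<le> B'" "poly_deg D' \<phi>"
    using assms poly_deg_mono by (auto simp: mult_bound_def)
  fix d and f :: "real ^ 'a \<Rightarrow> real" assume d: "d + D' \<le> N" and f: "poly_deg d f"
  have "eval_comb Z c (\<lambda>z. (\<phi> z * f z)\<^sup>2) \<le> B\<^sup>2 * eval_comb Z c (\<lambda>z. (f z)\<^sup>2)"
    using d assms(3) by (intro mult_boundD[OF assms(1) f]) simp
  also have "\<dots> \<le> B'\<^sup>2 * eval_comb Z c (\<lambda>z. (f z)\<^sup>2)"
    using d assms(1,2) pseudo_momentD[OF assms(4) f]
    by (intro mult_right_mono power_mono) (auto simp: mult_bound_def)
  finally show "eval_comb Z c (\<lambda>z. (\<phi> z * f z)\<^sup>2) \<le> B'\<^sup>2 * eval_comb Z c (\<lambda>z. (f z)\<^sup>2)" .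
qed

lemma mult_bound_const: "mult_bound N Z c 0 \<bar>b\<bar> (\<lambda>_. b)"
  by (simp add: mult_bound_def poly_deg_const power_mult_distrib eval_comb_cmult)

lemma mult_bound_mult:
  assumes "mult_bound N Z c D B \<phi>" "mult_bound N Z c E C \<psi>"
  shows "mult_bound N Z c (D + E) (B * C) (\<lambda>z. \<phi> z * \<psi> z)"
  unfolding mult_bound_def
proof (intro conjI allI impI)
  show "0 \<le> B * C" "poly_deg (D + E) (\<lambda>z. \<phi> z * \<psi> z)"
    using assms poly_deg_mult by (auto simp: mult_bound_def)
  fix d and f :: "real ^ 'a \<Rightarrow> real" assume d: "d + (D + E) \<le> N" and f: "poly_deg d f"
  have "poly_deg (E + d) (\<lambda>z. \<psi> z * f z)"
    using assms(2) f by (intro poly_deg_mult) (simp_all add: mult_bound_def)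
  then have "eval_comb Z c (\<lambda>z. (\<phi> z * (\<psi> z * f z))\<^sup>2) \<le> B\<^sup>2 * eval_comb Z c (\<lambda>z. (\<psi> z * f z)\<^sup>2)"
    using d by (intro mult_boundD[OF assms(1)]) auto
  also have "\<dots> \<le> B\<^sup>2 * (C\<^sup>2 * eval_comb Z c (\<lambda>z. (f z)\<^sup>2))"
    using d by (intro mult_left_mono mult_boundD[OF assms(2) f]) auto
  finally show "eval_comb Z c (\<lambda>z. (\<phi> z * \<psi> z * f z)\<^sup>2) \<le> (B * C)\<^sup>2 * eval_comb Z c (\<lambda>z. (f z)\<^sup>2)"
    by (simp add: power_mult_distrib mult.assoc)
qed

lemma mult_bound_cmult:
  assumes "mult_bound N Z c D B \<phi>"
  shows "mult_bound N Z c D (\<bar>b\<bar> * B) (\<lambda>z. b * \<phi> z)"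
  using mult_bound_mult[OF mult_bound_const assms] by simp

text \<open>Positivity on the square of \<open>(\<phi> - \<psi>) f\<close> yields \<open>(\<phi> +
  \<psi>)\<^sup>2 \<le> 2 \<phi>\<^sup>2 + 2 \<psi>\<^sup>2\<close> under the functional. The factor
  \<open>2\<close> replaces a Cauchy-Schwarz argument and is harmless, since only proportionality to
  \<delta> matters later.\<close>

lemma mult_bound_add:
  assumes "mult_bound N Z c D B \<phi>" "mult_bound N Z c E C \<psi>" "pseudo_moment N Z c"
  shows "mult_bound N Z c (D + E) (2 * (B + C)) (\<lambda>z. \<phi> z + \<psi> z)"
  unfolding mult_bound_def
proof (intro conjI allI impI)
  have BC: "0 \<le> B" "0 \<le> C" and deg: "poly_deg (D + E) \<phi>" "poly_deg (D + E) \<psi>"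
    using assms poly_deg_mono[of D _ "D + E"] poly_deg_mono[of E _ "D + E"]
    by (auto simp: mult_bound_def)
  show "0 \<le> 2 * (B + C)" "poly_deg (D + E) (\<lambda>z. \<phi> z + \<psi> z)"
    using BC deg poly_deg_add by auto
  fix d and f :: "real ^ 'a \<Rightarrow> real" assume d: "d + (D + E) \<le> N" and f: "poly_deg d f"
  have "0 \<le> eval_comb Z c (\<lambda>z. ((\<phi> z - \<psi> z) * f z)\<^sup>2)"
    using d by (intro pseudo_momentD[OF assms(3) poly_deg_mult[OF poly_deg_diff[OF deg] f]]) simp
  also have "(\<lambda>z. ((\<phi> z - \<psi> z) * f z)\<^sup>2) =
      (\<lambda>z. 2 * (\<phi> z * f z)\<^sup>2 + 2 * (\<psi> z * f z)\<^sup>2 - ((\<phi> z + \<psi> z) * f z)\<^sup>2)"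
    by (simp add: fun_eq_iff power2_eq_square algebra_simps)
  finally have "eval_comb Z c (\<lambda>z. ((\<phi> z + \<psi> z) * f z)\<^sup>2) \<le>
      2 * eval_comb Z c (\<lambda>z. (\<phi> z * f z)\<^sup>2) + 2 * eval_comb Z c (\<lambda>z. (\<psi> z * f z)\<^sup>2)"
    by (simp add: eval_comb_diff eval_comb_add eval_comb_cmult)
  also have "\<dots> \<le> 2 * (B\<^sup>2 * eval_comb Z c (\<lambda>z. (f z)\<^sup>2)) + 2 * (C\<^sup>2 * eval_comb Z c (\<lambda>z. (f z)\<^sup>2))"
    using d mult_boundD[OF assms(1) f] mult_boundD[OF assms(2) f] by (intro add_mono) auto
  also have "\<dots> = (2 * B\<^sup>2 + 2 * C\<^sup>2) * eval_comb Z c (\<lambda>z. (f z)\<^sup>2)" by (simp add: algebra_simps)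
  also have "\<dots> \<le> (2 * (B + C))\<^sup>2 * eval_comb Z c (\<lambda>z. (f z)\<^sup>2)"
  proof (rule mult_right_mono)
    show "2 * B\<^sup>2 + 2 * C\<^sup>2 \<le> (2 * (B + C))\<^sup>2"
      using BC by (simp add: power2_eq_square algebra_simps)
    show "0 \<le> eval_comb Z c (\<lambda>z. (f z)\<^sup>2)" using d by (intro pseudo_momentD[OF assms(3) f]) simp
  qed
  finally show "eval_comb Z c (\<lambda>z. ((\<phi> z + \<psi> z) * f z)\<^sup>2) \<le>
      (2 * (B + C))\<^sup>2 * eval_comb Z c (\<lambda>z. (f z)\<^sup>2)" .
qed

text \<open>The factor \<open>4\<close> per summand absorbs the doubling in
  \<open>mult_bound_add\<close>.\<close>

lemma mult_bound_sum:
  assumes "finite I" "\<And>i. i \<in> I \<Longrightarrow> mult_bound N Z c D B (\<phi> i)" "pseudo_moment N Z c" "0 \<le> B"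
  shows "mult_bound N Z c (card I * D) (4 ^ card I * B) (\<lambda>z. \<Sum>i\<in>I. \<phi> i z)"
  using assms(1,2)
proof (induction I rule: finite_induct)
  case empty
  then show ?case using mult_bound_mono[OF mult_bound_const[of N Z c 0]] assms(3,4) by simp
next
  case (insert i I)
  then have "mult_bound N Z c (D + card I * D) (2 * (B + 4 ^ card I * B)) (\<lambda>z. \<phi> i z + (\<Sum>i\<in>I. \<phi> i z))"
    using assms(3) by (intro mult_bound_add) auto
  moreover have "2 * (B + 4 ^ card I * B) \<le> 4 ^ Suc (card I) * B"
  proof -
    have "1 * B \<le> 4 ^ card I * B" using assms(4) by (intro mult_right_mono) simp_all
    then show ?thesis by (simp add: mult.commute)
  qed
  ultimately show ?case using insert.hyps assms(3) by (auto elim: mult_bound_mono)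
qed

text \<open>The ball constraint tested with \<open>f\<close> bounds the sum over all coordinates.
  Each term is \<open>L\<close> of a square, so a single coordinate obeys the same bound.\<close>

lemma mult_bound_coord:
  fixes a :: "real ^ 'n"
  assumes "ball_pseudo_moment N a \<delta> Z c" "0 \<le> \<delta>"
  shows "mult_bound N Z c 1 \<delta> (\<lambda>z. z $ i - a $ i)"
  unfolding mult_bound_def
proof (intro conjI allI impI)
  have deg: "poly_deg 1 (\<lambda>z :: real ^ 'n. z $ j - a $ j)" for j
    by (intro poly_deg_diff poly_deg_coord poly_deg_const)
  show "0 \<le> \<delta>" "poly_deg 1 (\<lambda>z. z $ i - a $ i)" using assms(2) deg by auto
  fix d and f :: "real ^ 'n \<Rightarrow> real" assume d: "d + 1 \<le> N" and f: "poly_deg d f"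
  have "0 \<le> eval_comb Z c (\<lambda>z. (\<delta>\<^sup>2 - (\<Sum>j\<in>UNIV. (z $ j - a $ j)\<^sup>2)) * (f z)\<^sup>2)"
    using assms(1) poly_deg_mono[OF f, of N] d by (simp add: ball_pseudo_moment_def)
  also have "\<dots> = \<delta>\<^sup>2 * eval_comb Z c (\<lambda>z. (f z)\<^sup>2) -
      (\<Sum>j\<in>UNIV. eval_comb Z c (\<lambda>z. ((z $ j - a $ j) * f z)\<^sup>2))"
    by (simp add: left_diff_distrib[of "\<delta>\<^sup>2"] sum_distrib_right power_mult_distrib eval_comb_diff
        eval_comb_cmult eval_comb_sum)
  finally have "(\<Sum>j\<in>UNIV. eval_comb Z c (\<lambda>z. ((z $ j - a $ j) * f z)\<^sup>2)) \<le>
      \<delta>\<^sup>2 * eval_comb Z c (\<lambda>z. (f z)\<^sup>2)" by simp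
  moreover have "0 \<le> eval_comb Z c (\<lambda>z. ((z $ j - a $ j) * f z)\<^sup>2)" for j
    using assms(1) d unfolding ball_pseudo_moment_def
    by (intro pseudo_momentD[OF _ poly_deg_mult[OF deg f]]) auto
  then have "eval_comb Z c (\<lambda>z. ((z $ i - a $ i) * f z)\<^sup>2) \<le>
      (\<Sum>j\<in>UNIV. eval_comb Z c (\<lambda>z. ((z $ j - a $ j) * f z)\<^sup>2))"
    by (intro member_le_sum[of i UNIV]) auto
  ultimately show "eval_comb Z c (\<lambda>z. ((z $ i - a $ i) * f z)\<^sup>2) \<le> \<delta>\<^sup>2 * eval_comb Z c (\<lambda>z. (f z)\<^sup>2)"
    by linarith
qed

text \<open>A weighted arithmetic-geometric mean inequality: expand \<open>L\<close> of the square
  of \<open>\<phi> f + B g\<close>, bound the part with \<open>(\<phi> f)\<^sup>2\<close> by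
  \<open>mult_bound\<close>, and divide by \<open>2 * B\<close>.\<close>

lemma mult_bound_cross:
  assumes "mult_bound N Z c D B \<phi>" "0 < B" "pseudo_moment N Z c"
    and f: "poly_deg d f" and g: "poly_deg d g" and d: "d + D \<le> N"
  shows "- (B / 2) * (eval_comb Z c (\<lambda>z. (f z)\<^sup>2) + eval_comb Z c (\<lambda>z. (g z)\<^sup>2)) \<le>
    eval_comb Z c (\<lambda>z. \<phi> z * (f z * g z))"
proof -
  have "poly_deg (D + d) (\<lambda>z. \<phi> z * f z + B * g z)"
    using assms(1) poly_deg_mono[OF g, of "D + d"]
    by (intro poly_deg_add poly_deg_mult f poly_deg_cmult) (auto simp: mult_bound_def)
  then have "0 \<le> eval_comb Z c (\<lambda>z. (\<phi> z * f z + B * g z)\<^sup>2)"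
    by (rule pseudo_momentD[OF assms(3)]) (use d in simp)
  also have "(\<lambda>z. (\<phi> z * f z + B * g z)\<^sup>2) =
      (\<lambda>z. (\<phi> z * f z)\<^sup>2 + (2 * B) * (\<phi> z * (f z * g z)) + B\<^sup>2 * (g z)\<^sup>2)"
    by (simp add: fun_eq_iff power2_eq_square algebra_simps)
  finally have "0 \<le> B\<^sup>2 * eval_comb Z c (\<lambda>z. (f z)\<^sup>2) +
      2 * B * eval_comb Z c (\<lambda>z. \<phi> z * (f z * g z)) + B\<^sup>2 * eval_comb Z c (\<lambda>z. (g z)\<^sup>2)"
    using mult_boundD[OF assms(1) f d]
    by (simp only: eval_comb_add eval_comb_cmult)
  also have "\<dots> = B * (B * eval_comb Z c (\<lambda>z. (f z)\<^sup>2) +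
      2 * eval_comb Z c (\<lambda>z. \<phi> z * (f z * g z)) + B * eval_comb Z c (\<lambda>z. (g z)\<^sup>2))"
    by (simp add: power2_eq_square algebra_simps)
  finally have "0 \<le> B * eval_comb Z c (\<lambda>z. (f z)\<^sup>2) +
      2 * eval_comb Z c (\<lambda>z. \<phi> z * (f z * g z)) + B * eval_comb Z c (\<lambda>z. (g z)\<^sup>2)"
    using assms(2) by (simp add: zero_le_mult_iff)
  then show ?thesis by (simp add: algebra_simps)
qed

text \<open>Induction over the construction of the polynomial, using the calculus of
  \<open>mult_bound\<close>. It matters that \<open>C\<close> and \<open>D\<close> depend on
  \<open>q\<close> and \<open>a\<close> alone: the degree \<open>N\<close> and the radius \<delta>
  are fixed later in terms of them.\<close>

lemma polynomial_oscillation_mult_bound: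
  fixes q :: "real ^ 'n \<Rightarrow> real" and a :: "real ^ 'n"
  assumes "real_polynomial_function q"
  shows "\<exists>C>0. \<exists>D. \<forall>\<delta> u s N Z c. 0 < \<delta> \<longrightarrow> \<delta> \<le> 1 \<longrightarrow> (\<forall>i. \<bar>u $ i - a $ i\<bar> \<le> \<delta>) \<longrightarrow>
    0 \<le> s \<longrightarrow> s \<le> 1 \<longrightarrow> ball_pseudo_moment N a \<delta> Z c \<longrightarrow>
    mult_bound N Z c D (C * \<delta>) (\<lambda>z. q (u + s *\<^sub>R (z - u)) - q a)"
    (is "\<exists>C>0. \<exists>D. ?P q C D")
  using assms
proof induction
  case (linear q)
  interpret bounded_linear q by fact
  define M where "M = (\<Sum>i\<in>UNIV. \<bar>q (axis i 1)\<bar>) + 1"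
  have "0 \<le> (\<Sum>i\<in>UNIV. \<bar>q (axis i 1)\<bar>)" by (simp add: sum_nonneg)
  then have "0 < M" unfolding M_def by linarith
  have M: "\<bar>q (axis i 1)\<bar> \<le> M" for i
    using member_le_sum[of i UNIV "\<lambda>i. \<bar>q (axis i 1)\<bar>"] by (simp add: M_def)
  \<comment> \<open>The displacement from \<open>a\<close> is
    \<open>(1 - s) (u - a) + s (z - a)\<close>: a constant with coordinates of size at most
    \<delta>, plus a part controlled by the ball. Adding the two costs a factor \<open>2\<close>,
    hence \<open>4 * \<delta>\<close> per coordinate; summing over the coordinates costs
    \<open>4 ^ CARD('n)\<close>.\<close>
  have "?P q (4 ^ CARD('n) * (M * 4)) (CARD('n) * 1)"
  proof (intro allI impI)
    fix \<delta> s :: real and N Z c and u :: "real ^ 'n"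
    assume \<delta>: "0 < \<delta>" "\<delta> \<le> 1" and u: "\<forall>i. \<bar>u $ i - a $ i\<bar> \<le> \<delta>" and s: "0 \<le> s" "s \<le> 1"
      and bpm: "ball_pseudo_moment N a \<delta> Z c"
    have pm: "pseudo_moment N Z c" using bpm by (simp add: ball_pseudo_moment_def)
    have "mult_bound N Z c 1 (M * 4 * \<delta>)
        (\<lambda>z. q (axis i 1) * ((1 - s) * (u $ i - a $ i) + s * (z $ i - a $ i)))" for i
    proof -
      have "mult_bound N Z c (0 + 1) (2 * (\<bar>(1 - s) * (u $ i - a $ i)\<bar> + \<bar>s\<bar> * \<delta>))
          (\<lambda>z. (1 - s) * (u $ i - a $ i) + s * (z $ i - a $ i))"
        using \<delta> by (intro mult_bound_add mult_bound_const mult_bound_cmult mult_bound_coord bpm pm) simp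
      from mult_bound_cmult[OF this] show ?thesis
      proof (rule mult_bound_mono[OF _ _ _ pm])
        have "\<bar>(1 - s) * (u $ i - a $ i)\<bar> \<le> 1 * \<delta>"
          unfolding abs_mult using s u by (intro mult_mono) auto
        moreover have "\<bar>s\<bar> * \<delta> \<le> 1 * \<delta>" using s \<delta> by (intro mult_right_mono) auto
        ultimately have "2 * (\<bar>(1 - s) * (u $ i - a $ i)\<bar> + \<bar>s\<bar> * \<delta>) \<le> 4 * \<delta>" by simp
        then have "\<bar>q (axis i 1)\<bar> * (2 * (\<bar>(1 - s) * (u $ i - a $ i)\<bar> + \<bar>s\<bar> * \<delta>)) \<le> M * (4 * \<delta>)"
          by (rule mult_mono[OF M]) (use \<delta> \<open>0 < M\<close> in auto)
        then show "\<bar>q (axis i 1)\<bar> * (2 * (\<bar>(1 - s) * (u $ i - a $ i)\<bar> + \<bar>s\<bar> * \<delta>)) \<le> M * 4 * \<delta>"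
          by simp
      qed simp
    qed
    then have "mult_bound N Z c (CARD('n) * 1) (4 ^ CARD('n) * (M * 4 * \<delta>))
        (\<lambda>z. \<Sum>i\<in>UNIV. q (axis i 1) * ((1 - s) * (u $ i - a $ i) + s * (z $ i - a $ i)))"
      using \<delta> \<open>0 < M\<close> by (intro mult_bound_sum pm) auto
    moreover have "q (u + s *\<^sub>R (z - u)) - q a =
        (\<Sum>i\<in>UNIV. q (axis i 1) * ((1 - s) * (u $ i - a $ i) + s * (z $ i - a $ i)))" for z
      unfolding diff[symmetric]
      by (subst bounded_linear_coord_expansion[OF \<open>bounded_linear q\<close>]) (simp add: algebra_simps)
    ultimately show "mult_bound N Z c (CARD('n) * 1) (4 ^ CARD('n) * (M * 4) * \<delta>)
        (\<lambda>z. q (u + s *\<^sub>R (z - u)) - q a)"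
      by (simp add: mult.assoc)
  qed
  moreover have "0 < 4 ^ CARD('n) * (M * 4)" using \<open>0 < M\<close> by simp
  ultimately show ?case by blast
next
  case (const b)
  have "?P (\<lambda>_. b) 1 0"
    by (auto simp: ball_pseudo_moment_def intro!: mult_bound_mono[OF mult_bound_const[of _ _ _ 0]])
  then show ?case using zero_less_one by blast
next
  case (add f g)
  then obtain C D C' D' where CD: "0 < C" "0 < C'" "?P f C D" "?P g C' D'" by blast
  have "?P (\<lambda>x. f x + g x) (2 * (C + C')) (D + D')"
  proof (intro allI impI)
    fix \<delta> s :: real and N Z c and u :: "real ^ 'n"
    assume *: "0 < \<delta>" "\<delta> \<le> 1" "\<forall>i. \<bar>u $ i - a $ i\<bar> \<le> \<delta>" "0 \<le> s" "s \<le> 1"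
      "ball_pseudo_moment N a \<delta> Z c"
    have "mult_bound N Z c (D + D') (2 * (C * \<delta> + C' * \<delta>))
        (\<lambda>z. (f (u + s *\<^sub>R (z - u)) - f a) + (g (u + s *\<^sub>R (z - u)) - g a))"
      using * CD by (intro mult_bound_add) (auto simp: ball_pseudo_moment_def)
    then show "mult_bound N Z c (D + D') (2 * (C + C') * \<delta>)
        (\<lambda>z. f (u + s *\<^sub>R (z - u)) + g (u + s *\<^sub>R (z - u)) - (f a + g a))"
      by (simp add: algebra_simps)
  qed
  moreover have "0 < 2 * (C + C')" using CD by simp
  ultimately show ?case by blast
next
  case (mult f g)
  then obtain C D C' D' where CD: "0 < C" "0 < C'" "?P f C D" "?P g C' D'" by blast
  \<comment> \<open>With the oscillations \<open>F\<close>, \<open>G\<close> of the factors, the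
    oscillation of the product is \<open>F G + g a * F + f a * G\<close>. The bound for
    \<open>F G\<close> is of order \<open>\<delta>\<^sup>2\<close>, which is at most \<delta>
    because \<open>\<delta> \<le> 1\<close>; \<open>C''\<close> collects the coefficients.\<close>
  define C'' where "C'' = 2 * (2 * (C * C' + \<bar>g a\<bar> * C) + \<bar>f a\<bar> * C')"
  have "?P (\<lambda>x. f x * g x) C'' (D + D' + D + D')"
  proof (intro allI impI)
    fix \<delta> s :: real and N Z c and u :: "real ^ 'n"
    assume *: "0 < \<delta>" "\<delta> \<le> 1" "\<forall>i. \<bar>u $ i - a $ i\<bar> \<le> \<delta>" "0 \<le> s" "s \<le> 1"
      "ball_pseudo_moment N a \<delta> Z c"
    have pm: "pseudo_moment N Z c" using *(6) by (simp add: ball_pseudo_moment_def)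
    let ?F = "\<lambda>z. f (u + s *\<^sub>R (z - u)) - f a" and ?G = "\<lambda>z. g (u + s *\<^sub>R (z - u)) - g a"
    have F: "mult_bound N Z c D (C * \<delta>) ?F" and G: "mult_bound N Z c D' (C' * \<delta>) ?G"
      using * CD by blast+
    have "mult_bound N Z c (D + D' + D + D')
        (2 * (2 * (C * \<delta> * (C' * \<delta>) + \<bar>g a\<bar> * (C * \<delta>)) + \<bar>f a\<bar> * (C' * \<delta>)))
        (\<lambda>z. ?F z * ?G z + g a * ?F z + f a * ?G z)"
      by (intro mult_bound_add mult_bound_mult mult_bound_cmult F G pm)
    moreover have "C * \<delta> * (C' * \<delta>) \<le> C * C' * \<delta>"
    proof -
      have "\<delta> * \<delta> \<le> 1 * \<delta>" using *(1,2) by (intro mult_right_mono) auto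
      then have "C * C' * (\<delta> * \<delta>) \<le> C * C' * \<delta>" using CD by (intro mult_left_mono) auto
      then show ?thesis by (simp add: mult_ac)
    qed
    then have "2 * (2 * (C * \<delta> * (C' * \<delta>) + \<bar>g a\<bar> * (C * \<delta>)) + \<bar>f a\<bar> * (C' * \<delta>)) \<le> C'' * \<delta>"
      by (simp add: C''_def algebra_simps)
    ultimately have "mult_bound N Z c (D + D' + D + D') (C'' * \<delta>)
        (\<lambda>z. ?F z * ?G z + g a * ?F z + f a * ?G z)"
      by (rule mult_bound_mono) (use pm in auto)
    then show "mult_bound N Z c (D + D' + D + D') (C'' * \<delta>)
        (\<lambda>z. f (u + s *\<^sub>R (z - u)) * g (u + s *\<^sub>R (z - u)) - f a * g a)"
      by (simp add: algebra_simps)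
  qed
  moreover have "0 < C''" using CD by (simp add: C''_def add_pos_nonneg)
  ultimately show ?case by blast
qed

text \<open>The variance about the mean is nonnegative, so \<open>(u $ i - a $ i)\<^sup>2\<close> is
  at most the second moment about \<open>a\<close>; the ball constraint with \<open>f = 1\<close>
  bounds the sum of these moments.\<close>

lemma ball_pseudo_moment_mean:
  fixes a u :: "real ^ 'n"
  assumes "ball_pseudo_moment N a \<delta> Z c" "1 \<le> N"
    and one: "eval_comb Z c (\<lambda>_. 1) = 1" and mean: "\<And>i. eval_comb Z c (\<lambda>z. z $ i) = u $ i"
  shows "(\<Sum>i\<in>UNIV. (u $ i - a $ i)\<^sup>2) \<le> \<delta>\<^sup>2"
proof -
  have "(u $ i - a $ i)\<^sup>2 \<le> eval_comb Z c (\<lambda>z. (z $ i - a $ i)\<^sup>2)" for i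
  proof -
    have "0 \<le> eval_comb Z c (\<lambda>z. (z $ i - u $ i)\<^sup>2)"
    proof (rule pseudo_momentD[of N])
      show "pseudo_moment N Z c" using assms(1) by (simp add: ball_pseudo_moment_def)
      show "poly_deg 1 (\<lambda>z :: real ^ 'n. z $ i - u $ i)"
        by (intro poly_deg_diff poly_deg_coord poly_deg_const)
    qed fact
    also have "(\<lambda>z. (z $ i - u $ i)\<^sup>2) =
        (\<lambda>z. (z $ i - a $ i)\<^sup>2 - (2 * (u $ i - a $ i)) * z $ i + ((u $ i)\<^sup>2 - (a $ i)\<^sup>2) * 1)"
      by (simp add: fun_eq_iff power2_eq_square algebra_simps)
    also have "eval_comb Z c \<dots> = eval_comb Z c (\<lambda>z. (z $ i - a $ i)\<^sup>2)
        - (2 * (u $ i - a $ i)) * u $ i + ((u $ i)\<^sup>2 - (a $ i)\<^sup>2)"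
      by (simp only: eval_comb_add eval_comb_diff eval_comb_cmult one mean) simp
    finally show ?thesis by (simp add: power2_eq_square algebra_simps)
  qed
  then have "(\<Sum>i\<in>UNIV. (u $ i - a $ i)\<^sup>2) \<le> (\<Sum>i\<in>UNIV. eval_comb Z c (\<lambda>z. (z $ i - a $ i)\<^sup>2))"
    by (intro sum_mono)
  also have "\<dots> \<le> \<delta>\<^sup>2"
  proof -
    have "0 \<le> eval_comb Z c (\<lambda>z. (\<delta>\<^sup>2 - (\<Sum>i\<in>UNIV. (z $ i - a $ i)\<^sup>2)) * 1\<^sup>2)"
      using assms(1) poly_deg_const[of N 1] unfolding ball_pseudo_moment_def by blast
    then show ?thesis
      using eval_comb_const[of Z c "\<delta>\<^sup>2"] one by (simp add: eval_comb_diff eval_comb_sum)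
  qed
  finally show ?thesis .
qed

text \<open>On the segment, minus the Hessian is \<open>- H\<close> plus an oscillation of order
  \<delta>. After splitting off \<open>l / 2\<close> times the identity, the rest of the form of
  \<open>- H\<close> is still positive definite, hence a sum of squares of linear forms; the part
  split off absorbs the oscillation for small \<delta>.\<close>

lemma local_Jensen:
  fixes p :: "real ^ 'n \<Rightarrow> real" and a :: "real ^ 'n"
  assumes p: "real_polynomial_function p" and "0 < l"
    and coercive: "\<And>v. l * (norm v)\<^sup>2 \<le> - (v \<bullet> (hessian p a *v v))"
  shows "\<exists>\<delta>0>0. \<exists>N\<ge>1. \<forall>\<delta> Z c u. 0 < \<delta> \<longrightarrow> \<delta> \<le> \<delta>0 \<longrightarrow> ball_pseudo_moment N a \<delta> Z c \<longrightarrow>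
    eval_comb Z c (\<lambda>_. 1) = 1 \<longrightarrow> (\<forall>i. eval_comb Z c (\<lambda>z. z $ i) = u $ i) \<longrightarrow>
    eval_comb Z c p \<le> p u"
proof -
  define H where "H = hessian p a"
  have norm_sq: "(norm v)\<^sup>2 = (\<Sum>i\<in>UNIV. (v $ i)\<^sup>2)" for v :: "real ^ 'n"
    unfolding power2_norm_eq_inner inner_vec_def by (simp add: power2_eq_square)
  \<comment> \<open>The symmetric part of \<open>- H\<close> minus \<open>l / 2\<close> times the
    identity; symmetrising leaves the form unchanged and prepares the Cholesky
    factorisation.\<close>
  define A where "A i j = - (H $ i $ j + H $ j $ i) / 2 - (if i = j then l / 2 else 0)" for i j
  have A: "(\<Sum>i\<in>UNIV. \<Sum>j\<in>UNIV. v $ i * A i j * v $ j) = - (v \<bullet> (H *v v)) - l / 2 * (norm v)\<^sup>2" for v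
  proof -
    have "(\<Sum>i\<in>UNIV. \<Sum>j\<in>UNIV. v $ i * A i j * v $ j) =
        (\<Sum>i\<in>UNIV. \<Sum>j\<in>UNIV. - (v $ i * v $ j * H $ i $ j) / 2 + - (v $ j * v $ i * H $ j $ i) / 2
          - (if i = j then l / 2 * (v $ i)\<^sup>2 else 0))"
      by (intro sum.cong refl) (simp add: A_def power2_eq_square field_simps)
    also have "\<dots> = - (v \<bullet> (H *v v)) / 2 +
        - (\<Sum>i\<in>UNIV. \<Sum>j\<in>UNIV. v $ j * v $ i * H $ j $ i) / 2 - l / 2 * (norm v)\<^sup>2"
      by (simp add: sum.distrib sum_subtractf sum_negf sum_divide_distrib quadratic_form_expand
          norm_sq sum_distrib_left)
    also have "(\<Sum>i\<in>UNIV. \<Sum>j\<in>UNIV. v $ j * v $ i * H $ j $ i) = v \<bullet> (H *v v)"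
      unfolding quadratic_form_expand by (rule sum.swap)
    finally show ?thesis by simp
  qed
  have "\<exists>(k::nat) w. \<forall>i\<in>UNIV. \<forall>j\<in>UNIV. A i j = (\<Sum>m<k. w m i * w m j)"
  proof (rule positive_definite_imp_sum_of_squares)
    show "A i j = A j i" for i j by (simp add: A_def)
    fix v :: "'n \<Rightarrow> real" assume v: "\<exists>i\<in>UNIV. v i \<noteq> 0"
    define v' where "v' = (\<chi> i. v i)"
    have "v' \<noteq> 0" using v by (auto simp: v'_def vec_eq_iff)
    then have "0 < l / 2 * (norm v')\<^sup>2" using \<open>0 < l\<close> by simp
    then have "0 < - (v' \<bullet> (H *v v')) - l / 2 * (norm v')\<^sup>2"
      using coercive[of v'] by (simp add: H_def)
    then show "0 < (\<Sum>i\<in>UNIV. \<Sum>j\<in>UNIV. v i * A i j * v j)"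
      unfolding A[symmetric] by (simp add: v'_def)
  qed simp
  then obtain k :: nat and w where w: "\<And>i j. A i j = (\<Sum>m<k. w m i * w m j)" by blast
  have form: "- (v \<bullet> (H *v v)) = l / 2 * (\<Sum>i\<in>UNIV. (v $ i)\<^sup>2) + (\<Sum>m<k. (\<Sum>i\<in>UNIV. w m i * v $ i)\<^sup>2)" for v
  proof -
    have "(\<Sum>m<k. (\<Sum>i\<in>UNIV. w m i * v $ i)\<^sup>2) = (\<Sum>i\<in>UNIV. \<Sum>j\<in>UNIV. v $ i * A i j * v $ j)"
      unfolding sum_of_squares_form[symmetric] w[symmetric] by (simp add: mult_ac)
    then show ?thesis unfolding A norm_sq by simp
  qed
  have "\<forall>i j. \<exists>C>0. \<exists>D. \<forall>\<delta> u s N Z c. 0 < \<delta> \<longrightarrow> \<delta> \<le> 1 \<longrightarrow> (\<forall>i. \<bar>u $ i - a $ i\<bar> \<le> \<delta>) \<longrightarrow>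
      0 \<le> s \<longrightarrow> s \<le> 1 \<longrightarrow> ball_pseudo_moment N a \<delta> Z c \<longrightarrow>
      mult_bound N Z c D (C * \<delta>) (\<lambda>z. hessian p (u + s *\<^sub>R (z - u)) $ i $ j - H $ i $ j)"
    unfolding H_def using polynomial_oscillation_mult_bound[OF real_polynomial_hessian[OF p]] by blast
  then obtain C D where C: "\<And>i j. 0 < C i j" and CD: "\<And>i j \<delta> u s N Z c. 0 < \<delta> \<Longrightarrow> \<delta> \<le> 1 \<Longrightarrow>
      (\<forall>i. \<bar>u $ i - a $ i\<bar> \<le> \<delta>) \<Longrightarrow> 0 \<le> s \<Longrightarrow> s \<le> 1 \<Longrightarrow> ball_pseudo_moment N a \<delta> Z c \<Longrightarrow>
      mult_bound N Z c (D i j) (C i j * \<delta>) (\<lambda>z. hessian p (u + s *\<^sub>R (z - u)) $ i $ j - H $ i $ j)"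
    by metis
  define M where "M = (\<Sum>i\<in>UNIV. \<Sum>j\<in>UNIV. C i j)"
  define E where "E = (\<Sum>i\<in>UNIV. \<Sum>j\<in>UNIV. D i j)"
  have CM: "C i j \<le> M" for i j
  proof -
    have "C i j \<le> (\<Sum>j\<in>UNIV. C i j)" using C by (intro member_le_sum) (auto simp: less_imp_le)
    also have "\<dots> \<le> M"
      unfolding M_def using C by (intro member_le_sum[of i UNIV]) (auto simp: less_imp_le sum_nonneg)
    finally show ?thesis .
  qed
  have DE: "D i j \<le> E" for i j
  proof -
    have "D i j \<le> (\<Sum>j\<in>UNIV. D i j)" by (intro member_le_sum) auto
    also have "\<dots> \<le> E" unfolding E_def by (intro member_le_sum[of i UNIV]) auto
    finally show ?thesis .
  qed
  have "0 < M" using CM C less_le_trans by blast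
  define n where "n = real CARD('n)"
  have "0 < n" by (simp add: n_def)
  \<comment> \<open>The cross terms cost at most \<open>M * \<delta> * n\<close> times the sum of
    the variances, and the second bound keeps this factor below \<open>l / 2\<close>; the bound
    \<open>1\<close> is the range of the oscillation estimate.\<close>
  define \<delta>0 where "\<delta>0 = min 1 (l / (2 * n * M))"
  \<comment> \<open>Room for a multiplier of degree at most \<open>E\<close> applied to the linear
    functions \<open>z $ i - u $ i\<close>.\<close>
  define N where "N = 1 + E"
  have main: "eval_comb Z c p \<le> p u" if \<delta>: "0 < \<delta>" "\<delta> \<le> \<delta>0" and bpm: "ball_pseudo_moment N a \<delta> Z c"
    and one: "eval_comb Z c (\<lambda>_. 1) = 1" and mean: "\<And>i. eval_comb Z c (\<lambda>z. z $ i) = u $ i"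
    for \<delta> Z c and u :: "real ^ 'n"
  proof (rule eval_comb_Jensen[OF p one mean])
    fix s :: real assume s: "0 \<le> s" "s \<le> 1"
    have pm: "pseudo_moment N Z c" using bpm by (simp add: ball_pseudo_moment_def)
    have u: "\<bar>u $ i - a $ i\<bar> \<le> \<delta>" for i
    proof -
      have "(u $ i - a $ i)\<^sup>2 \<le> (\<Sum>i\<in>UNIV. (u $ i - a $ i)\<^sup>2)" by (intro member_le_sum) auto
      also have "\<dots> \<le> \<delta>\<^sup>2" using ball_pseudo_moment_mean[OF bpm _ one mean] by (simp add: N_def)
      finally show ?thesis using \<delta>(1) abs_le_square_iff[of "u $ i - a $ i" \<delta>] by simp
    qed
    have \<delta>1: "\<delta> \<le> 1" "\<delta> \<le> l / (2 * n * M)" using \<delta>(2) by (auto simp: \<delta>0_def)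
    let ?\<Delta> = "\<lambda>i j z. hessian p (u + s *\<^sub>R (z - u)) $ i $ j - H $ i $ j"
    define V where "V i = eval_comb Z c (\<lambda>z. (z $ i - u $ i)\<^sup>2)" for i
    have deg: "poly_deg 1 (\<lambda>z :: real ^ 'n. z $ i - u $ i)" for i
      by (intro poly_deg_diff poly_deg_coord poly_deg_const)
    \<comment> \<open>The sign of minus the Hessian is moved into one linear factor, so that
      \<open>mult_bound_cross\<close> can be used with the oscillation itself as multiplier.\<close>
    have deg': "poly_deg 1 (\<lambda>z :: real ^ 'n. - 1 * (z $ i - u $ i))" for i
      by (intro poly_deg_cmult deg)
    have "0 \<le> V i" for i
      unfolding V_def by (rule pseudo_momentD[OF pm deg]) (simp add: N_def)
    have cross: "- (M * \<delta> / 2) * (V i + V j) \<le>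
        eval_comb Z c (\<lambda>z. ?\<Delta> i j z * ((- 1 * (z $ i - u $ i)) * (z $ j - u $ j)))" for i j
    proof -
      have "mult_bound N Z c E (M * \<delta>) (?\<Delta> i j)"
        by (rule mult_bound_mono[OF CD[OF \<delta>(1) \<delta>1(1) _ s bpm] _ DE pm])
          (use u CM \<delta>(1) in \<open>auto intro!: mult_right_mono\<close>)
      from mult_bound_cross[OF this _ pm deg' deg, of i j] show ?thesis
        using \<open>0 < M\<close> \<delta>(1) by (simp add: V_def N_def power2_commute[of "u $ i"])
    qed
    have split: "- ((z - u) \<bullet> (hessian p (u + s *\<^sub>R (z - u)) *v (z - u))) =
        l / 2 * (\<Sum>i\<in>UNIV. (z $ i - u $ i)\<^sup>2) + (\<Sum>m<k. (\<Sum>i\<in>UNIV. w m i * (z $ i - u $ i))\<^sup>2) +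
        (\<Sum>i\<in>UNIV. \<Sum>j\<in>UNIV. ?\<Delta> i j z * ((- 1 * (z $ i - u $ i)) * (z $ j - u $ j)))" for z
    proof -
      have "- ((z - u) \<bullet> (hessian p (u + s *\<^sub>R (z - u)) *v (z - u))) = - ((z - u) \<bullet> (H *v (z - u))) +
          (\<Sum>i\<in>UNIV. \<Sum>j\<in>UNIV. ?\<Delta> i j z * ((- 1 * (z $ i - u $ i)) * (z $ j - u $ j)))"
        unfolding quadratic_form_expand sum_negf[symmetric] sum.distrib[symmetric]
        by (intro sum.cong refl) (simp add: algebra_simps)
      then show ?thesis unfolding form by simp
    qed
    have "0 \<le> (l / 2 - M * \<delta> * n) * (\<Sum>i\<in>UNIV. V i)"
    proof -
      have "2 * n * M * \<delta> \<le> l" using \<delta>1(2) \<open>0 < M\<close> \<open>0 < n\<close> by (simp add: field_simps)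
      then show ?thesis using \<open>\<And>i. 0 \<le> V i\<close> by (intro mult_nonneg_nonneg sum_nonneg) (auto simp: mult_ac)
    qed
    \<comment> \<open>Each variance occurs \<open>2 * n\<close> times in the double sum, which turns
      \<open>M * \<delta> / 2\<close> into \<open>M * \<delta> * n\<close>.\<close>
    also have "\<dots> = l / 2 * (\<Sum>i\<in>UNIV. V i) + (\<Sum>i\<in>UNIV. \<Sum>j\<in>UNIV. - (M * \<delta> / 2) * (V i + V j))"
    proof -
      have "(\<Sum>i\<in>UNIV. \<Sum>j\<in>UNIV. V i + V j) = 2 * n * (\<Sum>i\<in>UNIV. V i)"
        by (simp add: sum.distrib n_def flip: sum_distrib_left)
      then show ?thesis unfolding sum_distrib_left[symmetric] by (simp add: algebra_simps)
    qed
    also have "\<dots> \<le> l / 2 * (\<Sum>i\<in>UNIV. V i) + 0 + (\<Sum>i\<in>UNIV. \<Sum>j\<in>UNIV.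
        eval_comb Z c (\<lambda>z. ?\<Delta> i j z * ((- 1 * (z $ i - u $ i)) * (z $ j - u $ j))))"
      using cross by (simp add: sum_mono)
    also have "\<dots> \<le> l / 2 * (\<Sum>i\<in>UNIV. V i) +
        (\<Sum>m<k. eval_comb Z c (\<lambda>z. (\<Sum>i\<in>UNIV. w m i * (z $ i - u $ i))\<^sup>2)) + (\<Sum>i\<in>UNIV. \<Sum>j\<in>UNIV.
        eval_comb Z c (\<lambda>z. ?\<Delta> i j z * ((- 1 * (z $ i - u $ i)) * (z $ j - u $ j))))"
    proof (intro add_right_mono add_left_mono sum_nonneg)
      fix m
      show "0 \<le> eval_comb Z c (\<lambda>z. (\<Sum>i\<in>UNIV. w m i * (z $ i - u $ i))\<^sup>2)"
        by (rule pseudo_momentD[OF pm poly_deg_sum[OF poly_deg_cmult[OF deg]]]) (simp add: N_def)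
    qed
    also have "\<dots> = eval_comb Z c (\<lambda>z. - ((z - u) \<bullet> (hessian p (u + s *\<^sub>R (z - u)) *v (z - u))))"
      unfolding split V_def by (simp only: eval_comb_add eval_comb_cmult eval_comb_sum)
    finally show "0 \<le> eval_comb Z c (\<lambda>z. - ((z - u) \<bullet> (hessian p (u + s *\<^sub>R (z - u)) *v (z - u))))" .
  qed
  have "0 < \<delta>0" using \<open>0 < l\<close> \<open>0 < n\<close> \<open>0 < M\<close> by (simp add: \<delta>0_def)
  moreover have "1 \<le> N" by (simp add: N_def)
  ultimately show ?thesis using main by blast
qed

subsection \<open>Positively curved boundaries\<close>

text \<open>The modified gradient is \<open>(1 - k * g)\<close> times the gradient of
  \<open>g\<close>. Differentiating again gives \<open>(1 - k * g)\<close> times the Hessian minus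
  \<open>k\<close> times the outer square of the gradient, and at a zero of \<open>g\<close> the
  first factor is \<open>1\<close>. Only the normal direction is affected.\<close>

lemma hessian_quadratic_modification:
  fixes g :: "real ^ 'n \<Rightarrow> real"
  assumes g: "real_polynomial_function g" and "g a = 0"
  shows "v \<bullet> (hessian (\<lambda>x. g x - k / 2 * (g x * g x)) a *v v) =
    v \<bullet> (hessian g a *v v) - k * (v \<bullet> gradient g a)\<^sup>2"
proof -
  let ?p = "\<lambda>x. g x - k / 2 * (g x * g x)"
  have p: "real_polynomial_function ?p" by (intro real_polynomial_function_diff real_polynomial_function.intros(2,4) g)
  note D = has_derivative_gradient[OF real_polynomial_differentiable]
  have "(?p has_derivative (\<lambda>v. v \<bullet> ((1 - k * g x) *\<^sub>R gradient g x))) (at x)" for x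
    by (auto intro!: derivative_eq_intros D[OF g] simp: algebra_simps)
  from this[THEN gradient_eqI]
  have 1: "(\<lambda>x. gradient ?p x $ i) = (\<lambda>x. (1 - k * g x) * gradient g x $ i)" for i
    by (simp add: fun_eq_iff)
  have "((\<lambda>x. (1 - k * g x) * gradient g x $ i) has_derivative
      (\<lambda>v. v \<bullet> (gradient (\<lambda>x. gradient g x $ i) a - (k * gradient g a $ i) *\<^sub>R gradient g a))) (at a)" for i
    by (auto intro!: derivative_eq_intros D[OF g] D[OF real_polynomial_gradient[OF g]]
        simp: algebra_simps \<open>g a = 0\<close>)
  from this[THEN gradient_eqI]
  have "hessian ?p a $ i $ j = hessian g a $ i $ j - k * (gradient g a $ i * gradient g a $ j)" for i j
    unfolding hessian_nth[OF p] hessian_nth[OF g] 1 by simp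
  moreover have "(v \<bullet> gradient g a)\<^sup>2 =
      (\<Sum>i\<in>UNIV. \<Sum>j\<in>UNIV. v $ i * v $ j * (gradient g a $ i * gradient g a $ j))"
    by (simp add: power2_eq_square inner_vec_def sum_product mult_ac)
  ultimately show ?thesis
    unfolding quadratic_form_expand
    by (simp add: right_diff_distrib sum_subtractf sum_distrib_left mult_ac)
qed

lemma mem_cball_coord:
  fixes a :: "real ^ 'n"
  assumes "0 \<le> \<delta>"
  shows "x \<in> cball a \<delta> \<longleftrightarrow> (\<Sum>i\<in>UNIV. (x $ i - a $ i)\<^sup>2) \<le> \<delta>\<^sup>2"
proof -
  have "dist a x = norm (x - a)" by (simp add: dist_norm norm_minus_commute)
  then show ?thesis using assms by (simp add: norm_le_square inner_vec_def power2_eq_square)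
qed

text \<open>Near \<open>a\<close> the sets \<open>{g \<ge> 0}\<close> and \<open>{g - k/2 g\<^sup>2 \<ge> 0}\<close> coincide, and the second polynomial is
  strongly concave there once \<open>k\<close> is large.\<close>

lemma poscurv_local_SDP_representable:
  fixes g :: "real ^ 'n \<Rightarrow> real"
  assumes g: "real_polynomial_function g" and "g a = 0"
    and curv: "\<And>v. v \<noteq> 0 \<Longrightarrow> v \<bullet> gradient g a = 0 \<Longrightarrow> 0 < - (v \<bullet> (hessian g a *v v))"
  shows "\<exists>\<delta>>0. SDP_representable (superlevel g \<inter> cball a \<delta>)"
proof -
  \<comment> \<open>Positive curvature is positivity of \<open>- hessian g a\<close> on the tangent
    space; Finsler's lemma extends it to all directions at the price of \<open>k\<close> times the
    square of \<open>v \<bullet> gradient g a\<close>.\<close>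
  have "\<exists>k>0. \<exists>l>0. \<forall>v. l * (norm v)\<^sup>2 \<le> v \<bullet> ((- hessian g a) *v v) + k * (v \<bullet> gradient g a)\<^sup>2"
  proof (rule Finsler)
    show "0 < v \<bullet> ((- hessian g a) *v v)" if "v \<noteq> 0" "v \<bullet> gradient g a = 0" for v
      using curv[OF that] by (simp add: quadratic_form_expand sum_negf)
  qed
  then obtain k l where k: "0 < k" and l: "0 < l"
    and kl: "\<And>v. l * (norm v)\<^sup>2 \<le> v \<bullet> ((- hessian g a) *v v) + k * (v \<bullet> gradient g a)\<^sup>2" by blast
  define p where "p x = g x - k / 2 * (g x * g x)" for x
  have p: "real_polynomial_function p"
    unfolding p_def[abs_def] by (intro real_polynomial_function_diff real_polynomial_function.intros(2,4) g)
  have "l * (norm v)\<^sup>2 \<le> - (v \<bullet> (hessian p a *v v))" for v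
    using kl[of v] unfolding p_def[abs_def] hessian_quadratic_modification[OF g \<open>g a = 0\<close>]
    by (simp add: quadratic_form_expand sum_negf)
  from local_Jensen[OF p l this] obtain \<delta>0 N where \<delta>0: "0 < \<delta>0" and N: "1 \<le> N"
    and Jensen: "\<And>\<delta> Z c u. 0 < \<delta> \<Longrightarrow> \<delta> \<le> \<delta>0 \<Longrightarrow> ball_pseudo_moment N a \<delta> Z c \<Longrightarrow>
      eval_comb Z c (\<lambda>_. 1) = 1 \<Longrightarrow> (\<forall>i. eval_comb Z c (\<lambda>z. z $ i) = u $ i) \<Longrightarrow> eval_comb Z c p \<le> p u"
    by blast
  have "isCont g a"
    using real_polynomial_differentiable[OF g] by (simp add: differentiable_imp_continuous_within)
  \<comment> \<open>Where \<open>\<bar>g x\<bar> < 1 / k\<close>, the second factor of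
    \<open>p x = g x * (1 - k * g x / 2)\<close> is positive, so \<open>p\<close> has the sign of
    \<open>g\<close>.\<close>
  then obtain e where e: "0 < e" "\<And>x. dist x a < e \<Longrightarrow> dist (g x) (g a) < 1 / k"
    using k unfolding continuous_at_eps_delta by (metis zero_less_divide_1_iff)
  define \<delta> where "\<delta> = min \<delta>0 (e / 2)"
  have \<delta>: "0 < \<delta>" "\<delta> \<le> \<delta>0" "\<delta> < e" using \<delta>0 e(1) by (auto simp: \<delta>_def)
  have sign: "0 \<le> p x \<longleftrightarrow> 0 \<le> g x" if "x \<in> cball a \<delta>" for x
  proof -
    have "dist x a < e" using that \<delta> by (simp add: dist_commute)
    then have "\<bar>g x\<bar> < 1 / k" using e(2) \<open>g a = 0\<close> by (simp add: dist_real_def)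
    then have "k * g x < 1" using k by (simp add: field_simps abs_less_iff)
    moreover have "p x = g x * (1 - k * g x / 2)" by (simp add: p_def algebra_simps)
    ultimately show ?thesis by (simp add: zero_le_mult_iff)
  qed
  \<comment> \<open>\<open>N\<close> is the degree that the local Jensen inequality asks of squares
    and of the ball constraint; \<open>p\<close> enters only through
    \<open>L p \<ge> 0\<close>.\<close>
  define W where "W = {(\<lambda>_. 1, N), (\<lambda>z. \<delta>\<^sup>2 - (\<Sum>i\<in>UNIV. (z $ i - a $ i)\<^sup>2), N), (p, 0)}"
  have "SDP_representable (superlevel g \<inter> cball a \<delta>)"
  proof (rule SDP_representable_moment_relaxation[of W])
    have "real_polynomial_function (\<lambda>z. \<delta>\<^sup>2 - (\<Sum>i\<in>UNIV. (z $ i - a $ i)\<^sup>2))"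
      unfolding power2_eq_square
      by (intro real_polynomial_function_diff real_polynomial_function_sum
          real_polynomial_function.intros(1,2,4) bounded_linear_vec_nth) auto
    then show "real_polynomial_function w" if "(w, d) \<in> W" for w d
      using that p by (auto simp: W_def)
    show "0 \<le> w x" if "x \<in> superlevel g \<inter> cball a \<delta>" "(w, d) \<in> W" for x w d
    proof -
      have x: "0 \<le> g x" "x \<in> cball a \<delta>" using that by (auto simp: superlevel_def)
      then show ?thesis
        using that(2) sign[OF x(2)] mem_cball_coord[of \<delta> x a] \<delta>(1) by (auto simp: W_def)
    qed
  next
    fix Z c and u :: "real ^ 'n"
    assume one: "eval_comb Z c (\<lambda>_. 1) = 1" and mean: "\<And>i. eval_comb Z c (\<lambda>z. z $ i) = u $ i"
      and pos: "\<And>w d f. (w, d) \<in> W \<Longrightarrow> poly_deg d f \<Longrightarrow> 0 \<le> eval_comb Z c (\<lambda>z. w z * (f z)\<^sup>2)"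
    have bpm: "ball_pseudo_moment N a \<delta> Z c"
      unfolding ball_pseudo_moment_def pseudo_moment_def
      using pos[of "\<lambda>_. 1" N] pos[of "\<lambda>z. \<delta>\<^sup>2 - (\<Sum>i\<in>UNIV. (z $ i - a $ i)\<^sup>2)" N] by (simp add: W_def)
    have "u \<in> cball a \<delta>"
      using ball_pseudo_moment_mean[OF bpm N one mean] \<delta>(1) by (subst mem_cball_coord) auto
    moreover have "0 \<le> eval_comb Z c p"
      using pos[of p 0 "\<lambda>_. 1"] by (simp add: W_def poly_deg_const)
    then have "0 \<le> p u" using Jensen[OF \<delta>(1,2) bpm one] mean by fastforce
    ultimately show "u \<in> superlevel g \<inter> cball a \<delta>" using sign by (simp add: superlevel_def)
  qed (simp add: W_def)
  then show ?thesis using \<delta>(1) by blast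
qed

text \<open>By compactness finitely many local pieces cover the boundary, the boundary contains all
  extreme points, and a compact convex set is the hull of those. So interior points need no pieces
  of their own.\<close>

lemma poscurv_convex_SDP_representable:
  fixes g :: "real ^ 'n \<Rightarrow> real"
  assumes g: "real_polynomial_function g" and pc: "poscurv_convex g" and "superlevel g \<noteq> {}"
  shows "SDP_representable (superlevel g)"
proof -
  let ?S = "superlevel g"
  have S: "compact ?S" "convex ?S" "frontier ?S = {x. g x = 0}"
    using pc by (auto simp: poscurv_convex_def)
  have "\<forall>a\<in>frontier ?S. \<exists>\<delta>>0. SDP_representable (?S \<inter> cball a \<delta>)"
    using pc S(3) by (auto simp: poscurv_convex_def intro!: poscurv_local_SDP_representable[OF g])
  then obtain \<delta> where \<delta>: "\<And>a. a \<in> frontier ?S \<Longrightarrow> 0 < \<delta> a"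
    "\<And>a. a \<in> frontier ?S \<Longrightarrow> SDP_representable (?S \<inter> cball a (\<delta> a))"
    by metis
  have "compact (frontier ?S)" using S(1) by (rule compact_frontier)
  moreover have "frontier ?S \<subseteq> (\<Union>a\<in>frontier ?S. ball a (\<delta> a))" using \<delta>(1) by fastforce
  ultimately obtain I where I: "I \<subseteq> frontier ?S" "finite I" "frontier ?S \<subseteq> (\<Union>a\<in>I. ball a (\<delta> a))"
    using compactE_image[of "frontier ?S" "frontier ?S" "\<lambda>a. ball a (\<delta> a)"] by auto
  have fS: "frontier ?S \<subseteq> ?S" using S(1) compact_imp_closed frontier_subset_closed by blast
  have hull: "?S = convex hull (\<Union>a\<in>I. ?S \<inter> cball a (\<delta> a))"
  proof
    have "{x. x extreme_point_of ?S} \<subseteq> frontier ?S"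
      using closure_subset
      by (auto simp: frontier_def extreme_point_not_in_interior extreme_point_of_def)
    also have "frontier ?S \<subseteq> (\<Union>a\<in>I. ?S \<inter> cball a (\<delta> a))"
    proof
      fix x assume x: "x \<in> frontier ?S"
      then obtain a where "a \<in> I" "x \<in> ball a (\<delta> a)" using I(3) by blast
      then show "x \<in> (\<Union>a\<in>I. ?S \<inter> cball a (\<delta> a))"
        using subsetD[OF fS x] by (intro UN_I[of a]) auto
    qed
    finally have "convex hull {x. x extreme_point_of ?S} \<subseteq> convex hull (\<Union>a\<in>I. ?S \<inter> cball a (\<delta> a))"
      by (rule hull_mono)
    then show "?S \<subseteq> convex hull (\<Union>a\<in>I. ?S \<inter> cball a (\<delta> a))"
      using Krein_Milman_Minkowski[OF S(1,2)] by simp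
    show "convex hull (\<Union>a\<in>I. ?S \<inter> cball a (\<delta> a)) \<subseteq> ?S" using S(2) by (intro hull_minimal) auto
  qed
  have "SDP_representable (convex hull (\<Union>a\<in>I. ?S \<inter> cball a (\<delta> a)))"
  proof (rule SDP_representable_convex_hull_UN[OF I(2)])
    show "I \<noteq> {}" using hull assms(3) by auto
    fix a assume "a \<in> I"
    then have a: "a \<in> frontier ?S" using I(1) by blast
    show "SDP_representable (?S \<inter> cball a (\<delta> a))" using a by (rule \<delta>(2))
    show "bounded (?S \<inter> cball a (\<delta> a))" by (simp add: bounded_Int)
    show "convex (?S \<inter> cball a (\<delta> a))" using S(2) by (intro convex_Int convex_cball)
    show "?S \<inter> cball a (\<delta> a) \<noteq> {}" using a fS \<delta>(1)[OF a] by force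
  qed
  then show ?thesis by (subst hull)
qed

theorem theorem3:
  fixes g :: "nat \<Rightarrow> real ^ 'n \<Rightarrow> real" and m :: nat and S :: "(real ^ 'n) set"
  assumes "\<forall>i\<in>{1..m}. real_polynomial_function (g i)"
    and "S = {x. \<forall>i\<in>{1..m}. g i x \<ge> 0}"
    and "compact S" and "convex S" and "interior S \<noteq> {}"
    and "\<forall>i\<in>{1..m}. sos_convex (g i) \<or> poscurv_convex (g i)"
  shows "SDP_representable S"
proof -
  have S: "S = (\<Inter>i\<in>{1..m}. superlevel (g i))"
    using assms(2) by (auto simp: superlevel_def)
  show ?thesis
    unfolding S
  proof (rule SDP_representable_INT)
    fix i assume i: "i \<in> {1..m}"
    \<comment> \<open>Nonemptiness passes from \<open>S\<close> to each superlevel set, so in the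
      positively curved case the finite cover of the boundary has at least one member.\<close>
    have "S \<noteq> {}" using assms(5) interior_subset by blast
    then have "superlevel (g i) \<noteq> {}" using S i by blast
    then show "SDP_representable (superlevel (g i))"
      using assms(1,6) i sos_convex_SDP_representable poscurv_convex_SDP_representable by blast
  qed simp
qed

end
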